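(* Let $a,b,c,d,e,f,g$ be complex numbers with $\max\{|bcdg|,|ce|,|cg|,|de|,|dg|\}<1$. Then $$\int_{c}^{d}\frac{(qt/c,qt/d,abcdet,fgt;q)_\infty}{(at,bt,et,gt;q)_\infty}\;{}_{3}\phi_2\left[\begin{array}{c}f,\ at,\ et\\ fgt,\ abcdet\end{array};q,bcdg\right]d_qt$$ $$=\frac{d(1-q)(q,dq/c,c/d,abcd,bcde,acde,cfg;q)_\infty}{(ac,ad,bc,bd,ce,cg,de;q)_\infty}\;{}_{3}\phi_2\left[\begin{array}{c}f,\ ac,\ ce\\ cfg,\ acde\end{array};q,dg\right].$$
   Context: Let $|q|<1$. The $q$-shifted factorials are $(x;q)_\infty=\prod_{k=0}^{\infty}(1-xq^k)$ and $(x;q)_n=(x;q)_\infty/(xq^n;q)_\infty$, with $(x_1,\ldots,x_m;q)_n=(x_1;q)_n\cdots(x_m;q)_n$ for $n$ an integer or $\infty$. The basic hypergeometric series ${}_3\phi_2$ is ${}_{3}\phi_2\left[\begin{array}{c}a_1,a_2,a_3\\ b_1,b_2\end{array};q,z\right]=\sum_{k=0}^\infty\frac{(a_1,a_2,a_3;q)_k}{(q,b_1,b_2;q)_k}z^k$. The $q$-integral is the Jackson integral $\int_c^d F(t)\,d_qt=\int_0^dF(t)\,d_qt-\int_0^cF(t)\,d_qt$, where $\int_0^xF(t)\,d_qt=x(1-q)\sum_{n=0}^\infty F(xq^n)q^n$. Here $e$ is a parameter, not the base of natural logarithms. As is standard for basic hypergeometric series, parameters are assumed to be such that no denominator vanishes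 (in particular $c,d\neq0$). *)

theory Defs
  imports "HOL-Analysis.Analysis"
begin

definition qpoch_inf :: "complex \<Rightarrow> complex \<Rightarrow> complex" where
  "qpoch_inf x q = (\<Prod>k. 1 - x * q ^ k)"

text \<open>
  For a natural number index the finite product is used instead of the quotient
  \<open>(x;q)\<^sub>\<infinity> / (x q^n;q)\<^sub>\<infinity>\<close>. The two agree wherever the quotient makes sense (lemma
  \<open>qpoch_eq_quotient\<close> below), but the quotient is of the form 0/0 when \<open>x q^m = 1\<close> for some
  \<open>m \<ge> n\<close>, which happens for the numerator parameters of a terminating series.
\<close>
definition qpoch :: "complex \<Rightarrow> complex \<Rightarrow> nat \<Rightarrow> complex" where
  "qpoch x q n = (\<Prod>k<n. 1 - x * q ^ k)"

definition qpochs_inf :: "complex list \<Rightarrow> complex \<Rightarrow> complex" where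
  "qpochs_inf xs q = (\<Prod>x\<leftarrow>xs. qpoch_inf x q)"

definition qpochs :: "complex list \<Rightarrow> complex \<Rightarrow> nat \<Rightarrow> complex" where
  "qpochs xs q n = (\<Prod>x\<leftarrow>xs. qpoch x q n)"

definition phi32 ::
  "complex \<Rightarrow> complex \<Rightarrow> complex \<Rightarrow> complex \<Rightarrow> complex \<Rightarrow> complex \<Rightarrow> complex \<Rightarrow> complex" where
  "phi32 a1 a2 a3 b1 b2 q z =
     (\<Sum>k. qpochs [a1, a2, a3] q k / qpochs [q, b1, b2] q k * z ^ k)"

definition jackson0 :: "complex \<Rightarrow> complex \<Rightarrow> (complex \<Rightarrow> complex) \<Rightarrow> complex" where
  "jackson0 q x F = x * (1 - q) * (\<Sum>n. F (x * q ^ n) * q ^ n)"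

definition jackson :: "complex \<Rightarrow> complex \<Rightarrow> complex \<Rightarrow> (complex \<Rightarrow> complex) \<Rightarrow> complex" where
  "jackson q c d F = jackson0 q d F - jackson0 q c F"

lemma qpoch_inf_LIMSEQ:
  assumes "norm q < 1"
  shows "qpoch x q \<longlonglongrightarrow> qpoch_inf x q"
proof -
  have "summable (\<lambda>k. norm ((1 - x * q ^ k) - 1))"
    using assms by (simp add: norm_mult norm_power summable_mult summable_geometric)
  then have "convergent_prod (\<lambda>k. 1 - x * q ^ k)"
    by (intro abs_convergent_prod_imp_convergent_prod summable_imp_abs_convergent_prod)
  then have "(\<lambda>n. \<Prod>k\<le>n. 1 - x * q ^ k) \<longlonglongrightarrow> qpoch_inf x q"
    unfolding qpoch_inf_def by (rule convergent_prod_LIMSEQ)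
  then show ?thesis
    by (simp add: qpoch_def[abs_def] LIMSEQ_lessThan_iff_atMost[where f = "prod (\<lambda>k. 1 - x * q ^ k)"])
qed

lemma qpoch_eq_quotient:
  assumes "norm q < 1" and "qpoch_inf (x * q ^ n) q \<noteq> 0"
  shows "qpoch x q n = qpoch_inf x q / qpoch_inf (x * q ^ n) q"
proof -
  have split: "qpoch x q (m + n) = qpoch x q n * qpoch (x * q ^ n) q m" for m
    by (induction m) (simp_all add: qpoch_def power_add mult_ac)
  have "(\<lambda>m. qpoch x q (m + n)) \<longlonglongrightarrow> qpoch x q n * qpoch_inf (x * q ^ n) q"
    unfolding split by (intro tendsto_mult tendsto_const qpoch_inf_LIMSEQ assms)
  moreover have "(\<lambda>m. qpoch x q (m + n)) \<longlonglongrightarrow> qpoch_inf x q"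
    by (intro LIMSEQ_ignore_initial_segment qpoch_inf_LIMSEQ assms)
  ultimately have "qpoch x q n * qpoch_inf (x * q ^ n) q = qpoch_inf x q"
    by (rule LIMSEQ_unique)
  then show ?thesis using assms by (simp add: field_simps)
qed

end

theory Submission
  imports Defs
begin

text \<open>
Write \<open>(x)\<^sub>\<infinity>\<close> for the infinite q-shifted factorial. The theorem is a q-differentiated form of the
q-beta integral of Al-Salam and Verma,
\<open>\<integral>\<^sub>c\<^sup>d (qt/c, qt/d, abcdet)\<^sub>\<infinity> / (at, bt, et)\<^sub>\<infinity> d\<^sub>q t =
  d(1-q) (q, dq/c, c/d, abcd, bcde, acde)\<^sub>\<infinity> / (ac, ad, bc, bd, ce, de)\<^sub>\<infinity>\<close>.
Divide both sides by \<open>(abcd)\<^sub>\<infinity>\<close>. The parameter \<open>a\<close> then occurs on both sides only through a quotient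
\<open>h(a) = (aru)\<^sub>\<infinity> / (as, ar)\<^sub>\<infinity>\<close>: with \<open>(s, r, u) = (t, bcd, et)\<close> under the integral and with
\<open>(s, r, u) = (c, d, ce)\<close> on the right. The operator \<open>\<Sum>\<^sub>k (f;q)\<^sub>k/(q;q)\<^sub>k g^k D^k\<close>, where
\<open>D h(a) = (h(a) - h(aq))/a\<close> is the q-derivative in \<open>a\<close>, maps \<open>h\<close> to
\<open>(aru, fgs)\<^sub>\<infinity> / (as, ar, gs)\<^sub>\<infinity>\<close> times the 3-phi-2 series with upper parameters \<open>f, as, u\<close>, lower
parameters \<open>fgs, aru\<close> and argument \<open>gr\<close>. For the two choices of \<open>(s, r, u)\<close> these are the two series
of the theorem.

To make this rigorous without operators of infinite order, the proof compares the two sides for each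
power \<open>D^k\<close> separately. Up to the factor \<open>(q;q)\<^sub>k/(ar)\<^sub>\<infinity>\<close>, the function \<open>D^k h\<close> is the finite sum
\<open>qdiff_kernel\<close>. Since \<open>(abcd)\<^sub>\<infinity>\<close> may vanish, the factor \<open>1/(ar)\<^sub>\<infinity>\<close> is left out there, which twists the
q-difference equation by a factor \<open>1 - ar\<close> (\<open>qdiff_kernel_step\<close>). Induction on \<open>k\<close> with this equation
integrates every kernel (\<open>kernel_integral_eval\<close>). The case \<open>k = 0\<close> is the beta integral
(\<open>qbeta_eval\<close>). At \<open>a = 0\<close>, where \<open>D\<close> is undefined, both sides are compared as limits.
Multiplying by \<open>(f;q)\<^sub>k g^k\<close> and summing over \<open>k\<close> then gives the theorem: both resulting series are
evaluated by \<open>qdiff_kernel_generating_function\<close>, an application of the q-binomial theorem, and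
summation and q-integration are interchanged by domination (\<open>jackson0_suminf_kernel\<close>).

The beta integral is proved by moving one parameter at a time to 0. The substitution \<open>a \<mapsto> aq\<close>
multiplies it by an explicit factor, because a combination of the two integrands telescopes along the
orbits \<open>c q^n\<close> and \<open>d q^n\<close>. Iterating sends \<open>a\<close> to 0. The remaining constant, the integral with
\<open>a = b = e = 0\<close>, follows from the choice \<open>e = q/c\<close> or, with the endpoints exchanged, \<open>e = q/d\<close>: there
the integral telescopes by itself.
\<close>

section \<open>Rearranging dominated double series\<close>

lemma summable_on_product_dominated:
  fixes F :: "nat \<Rightarrow> nat \<Rightarrow> complex" and A B :: "nat \<Rightarrow> real"
  assumes "summable A" "summable B"
    and nonneg: "\<And>n. 0 \<le> A n" "\<And>k. 0 \<le> B k"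
    and bound: "\<And>n k. norm (F n k) \<le> A n * B k"
  shows "(\<lambda>(n, k). F n k) summable_on (UNIV \<times> UNIV)"
proof -
  have A: "A summable_on UNIV" and B: "B summable_on UNIV"
    using assms by (auto intro!: summable_nonneg_imp_summable_on)
  have "(\<lambda>(n, k). A n * B k) summable_on (UNIV \<times> UNIV)"
  proof (rule summable_on_SigmaI)
    show "((\<lambda>k. case (n, k) of (n, k) \<Rightarrow> A n * B k) has_sum A n * infsum B UNIV) UNIV" for n
      using B by (auto intro!: has_sum_cmult_right)
    show "(\<lambda>n. A n * infsum B UNIV) summable_on UNIV"
      using A by (rule summable_on_cmult_left)
  qed (use nonneg in auto)
  then have "(\<lambda>p. norm (case p of (n, k) \<Rightarrow> F n k)) summable_on (UNIV \<times> UNIV)"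
    by (rule Infinite_Sum.abs_summable_on_comparison_test') (use bound in auto)
  then show ?thesis
    by (rule abs_summable_summable)
qed

lemma sums_rows:
  fixes F :: "nat \<Rightarrow> nat \<Rightarrow> complex"
  assumes "(\<lambda>(n, k). F n k) summable_on (UNIV \<times> UNIV)"
  shows "(\<lambda>n. \<Sum>k. F n k) sums infsum (\<lambda>(n, k). F n k) (UNIV \<times> UNIV)"
proof (rule has_sum_imp_sums, rule has_sum_Sigma')
  show "((\<lambda>(n, k). F n k) has_sum infsum (\<lambda>(n, k). F n k) (UNIV \<times> UNIV)) (UNIV \<times> UNIV)"
    using assms by auto
  fix n
  have "F n summable_on UNIV"
    using assms by (rule summable_on_SigmaD1) auto
  moreover from this have "infsum (F n) UNIV = (\<Sum>k. F n k)"
    by (metis has_sum_imp_sums has_sum_infsum sums_unique)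
  ultimately show "((\<lambda>k. case (n, k) of (n, k) \<Rightarrow> F n k) has_sum (\<Sum>k. F n k)) UNIV"
    by (simp add: has_sum_infsum flip: \<open>infsum (F n) UNIV = _\<close>)
qed

lemma sums_columns:
  fixes F :: "nat \<Rightarrow> nat \<Rightarrow> complex"
  assumes "(\<lambda>(n, k). F n k) summable_on (UNIV \<times> UNIV)"
  shows "(\<lambda>k. \<Sum>n. F n k) sums (\<Sum>n. \<Sum>k. F n k)"
proof -
  have sw: "(\<lambda>(k, n). F n k) summable_on (UNIV \<times> UNIV)"
    using assms summable_on_swap[of "\<lambda>(n, k). F n k" UNIV UNIV] by simp
  have "infsum (\<lambda>(n, k). F n k) (UNIV \<times> UNIV) = infsum (\<lambda>(k, n). F n k) (UNIV \<times> UNIV)"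
  proof (rule sym, rule infsumI)
    show "((\<lambda>(k, n). F n k) has_sum infsum (\<lambda>(n, k). F n k) (UNIV \<times> UNIV)) (UNIV \<times> UNIV)"
      using has_sum_infsum[OF assms] has_sum_swap[of "\<lambda>(n, k). F n k" UNIV UNIV] by simp
  qed
  then show ?thesis
    using sums_rows[OF assms] sums_rows[OF sw] by (simp add: sums_iff)
qed

text \<open>
A Cauchy product for double series whose terms need not factorise. It is used with terms containing
\<open>(f;q)\<^sub>j\<^sub>+\<^sub>m\<close>.
\<close>

lemma sums_antidiagonals:
  fixes F :: "nat \<Rightarrow> nat \<Rightarrow> complex"
  assumes "(\<lambda>(n, k). F n k) summable_on (UNIV \<times> UNIV)"
  shows "(\<lambda>k. \<Sum>j\<le>k. F j (k - j)) sums (\<Sum>j. \<Sum>m. F j m)"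
proof (rule has_sum_imp_sums, rule has_sum_Sigma')
  have "(\<Sum>j. \<Sum>m. F j m) = infsum (\<lambda>(n, k). F n k) (UNIV \<times> UNIV)"
    using sums_rows[OF assms] by (simp add: sums_iff)
  then have "((\<lambda>(n, k). F n k) has_sum (\<Sum>j. \<Sum>m. F j m)) (UNIV \<times> UNIV)"
    using assms by simp
  then show "((\<lambda>(k, j). F j (k - j)) has_sum (\<Sum>j. \<Sum>m. F j m)) (SIGMA k:UNIV. {..k})"
    by (subst has_sum_reindex_bij_witness[where i = "\<lambda>(j, m). (j + m, j)"
          and j = "\<lambda>(k, j). (j, k - j)" and T = "UNIV \<times> UNIV"]) auto
qed (auto intro!: has_sum_finiteI)

lemma summable_convolution_powers:
  fixes X Y :: real
  assumes "0 \<le> X" "X < 1" "0 \<le> Y" "Y < 1"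
  shows "summable (\<lambda>k. \<Sum>j\<le>k. X ^ j * Y ^ (k - j))"
  using assms by (intro summable_Cauchy_product) auto

section \<open>q-shifted factorials\<close>

lemma qpoch_0 [simp]: "qpoch x q 0 = 1"
  by (simp add: qpoch_def)

lemma qpoch_Suc: "qpoch x q (Suc n) = qpoch x q n * (1 - x * q ^ n)"
  by (simp add: qpoch_def)

lemma qpoch_add: "qpoch x q (n + m) = qpoch x q n * qpoch (x * q ^ n) q m"
  by (induction m) (simp_all add: qpoch_Suc power_add mult_ac)

lemma qpoch_zero_left [simp]: "qpoch 0 q n = 1"
  by (simp add: qpoch_def)

text \<open>
With \<open>D h(a) = (h(a) - h(aq))/a\<close> and \<open>h(a) = (aru)\<^sub>\<infinity> / (as, ar)\<^sub>\<infinity>\<close>, the value of the kernel is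
\<open>(ar)\<^sub>\<infinity> / (q;q)\<^sub>k\<close> times \<open>D^k h(a)\<close>, written out by the q-Leibniz rule. This expression also makes sense at
\<open>a = 0\<close> and at the zeros of \<open>(ar)\<^sub>\<infinity>\<close>.
\<close>

definition qdiff_kernel :: "complex \<Rightarrow> nat \<Rightarrow> complex \<Rightarrow> complex \<Rightarrow> complex \<Rightarrow> complex \<Rightarrow> complex" where
  "qdiff_kernel q k a s r u = (\<Sum>j\<le>k. r ^ j * s ^ (k - j) * qpoch u q j
      * (qpoch_inf (a * r * u * q ^ j) q / qpoch_inf (a * s * q ^ j) q)
      / (qpoch q q j * qpoch q q (k - j)))"

lemma jackson0_cong:
  assumes "\<And>n. F (x * q ^ n) = G (x * q ^ n)"
  shows "jackson0 q x F = jackson0 q x G"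
  using assms by (simp add: jackson0_def)

context
  fixes q :: complex
  assumes norm_q: "norm q < 1"
begin

lemma qpoch_inf_split: "qpoch_inf x q = qpoch x q n * qpoch_inf (x * q ^ n) q"
proof (rule LIMSEQ_unique)
  show "(\<lambda>m. qpoch x q (n + m)) \<longlonglongrightarrow> qpoch x q n * qpoch_inf (x * q ^ n) q"
    unfolding qpoch_add by (intro tendsto_intros qpoch_inf_LIMSEQ norm_q)
  show "(\<lambda>m. qpoch x q (n + m)) \<longlonglongrightarrow> qpoch_inf x q"
    by (subst add.commute) (intro LIMSEQ_ignore_initial_segment qpoch_inf_LIMSEQ norm_q)
qed

lemma qpoch_inf_step: "qpoch_inf x q = (1 - x) * qpoch_inf (x * q) q"
  using qpoch_inf_split[of x 1] by (simp add: qpoch_def)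

lemma qpoch_inf_zero_left [simp]: "qpoch_inf 0 q = 1"
  by (simp add: qpoch_inf_def)

lemma qpoch_inf_one [simp]: "qpoch_inf 1 q = 0"
  by (simp add: qpoch_inf_step[of 1])

text \<open>
The comparison with the exponential is uniform in the length of the product. It therefore passes to the
infinite product, bounds all q-shifted factorials for bounded \<open>x\<close>, and yields their limit 1 as \<open>x\<close> tends to 0.
\<close>

lemma norm_qpoch_minus_1: "norm (qpoch x q n - 1) \<le> exp (norm x / (1 - norm q)) - 1"
proof -
  have "norm (qpoch x q n - 1) \<le> (\<Prod>k<n. 1 + norm (- x * q ^ k)) - 1"
    using norm_prod_minus1_le_prod_minus1[of "\<lambda>k. - x * q ^ k" "{..<n}"] by (simp add: qpoch_def)
  also have "(\<Prod>k<n. 1 + norm (- x * q ^ k)) \<le> (\<Prod>k<n. exp (norm x * norm q ^ k))"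
    by (intro prod_mono) (auto simp: norm_mult norm_power exp_ge_add_one_self)
  also have "\<dots> = exp (norm x * (\<Sum>k<n. norm q ^ k))"
    by (simp add: exp_sum sum_distrib_left)
  also have "(\<Sum>k<n. norm q ^ k) \<le> 1 / (1 - norm q)"
    using sum_le_suminf[of "\<lambda>k. norm q ^ k" "{..<n}"] norm_q
    by (simp add: suminf_geometric summable_geometric)
  finally show ?thesis
    by (simp add: mult_left_mono)
qed

lemma norm_qpoch_inf_minus_1: "norm (qpoch_inf x q - 1) \<le> exp (norm x / (1 - norm q)) - 1"
proof (rule LIMSEQ_le_const2)
  show "(\<lambda>n. norm (qpoch x q n - 1)) \<longlonglongrightarrow> norm (qpoch_inf x q - 1)"
    by (intro tendsto_intros qpoch_inf_LIMSEQ norm_q)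
qed (use norm_qpoch_minus_1 in blast)

lemma norm_qpoch_le: "norm (qpoch x q n) \<le> exp (norm x / (1 - norm q))"
  using norm_qpoch_minus_1[of x n] norm_triangle_ineq2[of "qpoch x q n" 1] by simp

lemma norm_qpoch_inf_le: "norm (qpoch_inf x q) \<le> exp (norm x / (1 - norm q))"
  using norm_qpoch_inf_minus_1[of x] norm_triangle_ineq2[of "qpoch_inf x q" 1] by simp

lemma tendsto_qpoch_inf_0:
  assumes "(h \<longlongrightarrow> 0) F"
  shows "((\<lambda>i. qpoch_inf (h i) q) \<longlongrightarrow> 1) F"
proof -
  have lim: "((\<lambda>i. exp (norm (h i) / (1 - norm q)) - 1) \<longlongrightarrow> exp (norm (0::complex) / (1 - norm q)) - 1) F"
    by (intro tendsto_intros assms) (use norm_q in auto)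
  have "((\<lambda>i. qpoch_inf (h i) q - 1) \<longlongrightarrow> 0) F"
  proof (rule Lim_null_comparison[rotated])
    show "((\<lambda>i. exp (norm (h i) / (1 - norm q)) - 1) \<longlongrightarrow> 0) F"
      using lim by simp
  qed (simp add: norm_qpoch_inf_minus_1)
  then show ?thesis
    by (rule LIM_zero_cancel)
qed

lemma tendsto_mult_power_q: "(\<lambda>n. x * q ^ n) \<longlonglongrightarrow> 0"
  by (intro tendsto_mult_right_zero LIMSEQ_power_zero norm_q)

text \<open>
A tail of the product is close to 1, so only the finitely many factors in front of it can make it vanish.
\<close>

lemma qpoch_inf_nonzero:
  assumes "\<And>n. x * q ^ n \<noteq> 1"
  shows "qpoch_inf x q \<noteq> 0"
proof -
  have "eventually (\<lambda>n. qpoch_inf (x * q ^ n) q \<noteq> 0) sequentially"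
    using tendsto_qpoch_inf_0[OF tendsto_mult_power_q]
    by (rule tendsto_imp_eventually_ne) simp
  then obtain n where "qpoch_inf (x * q ^ n) q \<noteq> 0"
    by (auto simp: eventually_sequentially)
  moreover have "qpoch x q n \<noteq> 0"
    using assms by (auto simp: qpoch_def)
  ultimately show ?thesis
    using qpoch_inf_split[of x n] by simp
qed

lemma qpoch_nonzero: "qpoch_inf x q \<noteq> 0 \<Longrightarrow> qpoch x q n \<noteq> 0"
  using qpoch_inf_split[of x n] by auto

lemma qpoch_inf_shift_nonzero: "qpoch_inf x q \<noteq> 0 \<Longrightarrow> qpoch_inf (x * q ^ n) q \<noteq> 0"
  using qpoch_inf_split[of x n] by auto

lemma mult_power_q_neq_1:
  assumes "norm x < 1"
  shows "x * q ^ n \<noteq> 1"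
proof -
  have "norm (x * q ^ n) \<le> norm x * 1"
    unfolding norm_mult norm_power using norm_q by (intro mult_left_mono power_le_one) auto
  with assms show ?thesis
    by (auto dest: arg_cong[where f = norm])
qed

lemma qpoch_inf_nonzero_small: "norm x < 1 \<Longrightarrow> qpoch_inf x q \<noteq> 0"
  by (intro qpoch_inf_nonzero mult_power_q_neq_1)

lemma qpoch_q_nonzero [simp]: "qpoch q q n \<noteq> 0"
  by (intro qpoch_nonzero qpoch_inf_nonzero_small norm_q)

lemma qpoch_inf_q_nonzero [simp]: "qpoch_inf q q \<noteq> 0"
  by (intro qpoch_inf_nonzero_small norm_q)

lemma bounded_qpoch:
  assumes "R \<ge> 0"
  obtains M where "M > 0" "\<And>x n. norm x \<le> R \<Longrightarrow> norm (qpoch x q n) \<le> M"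
    "\<And>x. norm x \<le> R \<Longrightarrow> norm (qpoch_inf x q) \<le> M"
proof (rule that)
  have mono: "exp (norm x / (1 - norm q)) \<le> exp (R / (1 - norm q))" if "norm x \<le> R" for x :: complex
    using that norm_q by (simp add: divide_right_mono)
  show "norm (qpoch x q n) \<le> exp (R / (1 - norm q))" if "norm x \<le> R" for x n
    using norm_qpoch_le mono[OF that] by (rule order_trans)
  show "norm (qpoch_inf x q) \<le> exp (R / (1 - norm q))" if "norm x \<le> R" for x
    using norm_qpoch_inf_le mono[OF that] by (rule order_trans)
qed simp

lemma bounded_inverse_orbit:
  assumes "qpoch_inf x q \<noteq> 0"
  obtains M where "M > 0" "\<And>n. norm (inverse (qpoch_inf (x * q ^ n) q)) \<le> M"
proof -
  have "(\<lambda>n. inverse (qpoch_inf (x * q ^ n) q)) \<longlonglongrightarrow> inverse 1"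
    by (intro tendsto_inverse tendsto_qpoch_inf_0 tendsto_mult_power_q) simp
  then have "Bseq (\<lambda>n. inverse (qpoch_inf (x * q ^ n) q))"
    by (intro convergent_imp_Bseq) (auto simp: convergent_def)
  then show ?thesis
    using that by (auto elim: BseqE)
qed

lemma bounded_inverse_qpoch_q:
  obtains M where "M > 0" "\<And>n. norm (inverse (qpoch q q n)) \<le> M"
proof -
  have "(\<lambda>n. inverse (qpoch q q n)) \<longlonglongrightarrow> inverse (qpoch_inf q q)"
    by (intro tendsto_inverse qpoch_inf_LIMSEQ norm_q) simp
  then have "Bseq (\<lambda>n. inverse (qpoch q q n))"
    by (intro convergent_imp_Bseq) (auto simp: convergent_def)
  then show ?thesis
    using that by (auto elim: BseqE)
qed

lemma bounded_inverse_near_0: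
  obtains r where "r > 0" "\<And>x. norm x < r \<Longrightarrow> qpoch_inf x q \<noteq> 0 \<and> norm (inverse (qpoch_inf x q)) \<le> 2"
proof -
  have "((\<lambda>x. norm (qpoch_inf x q)) \<longlongrightarrow> norm (1::complex)) (nhds 0)"
    by (intro tendsto_norm tendsto_qpoch_inf_0) (simp add: filterlim_ident)
  then have "eventually (\<lambda>x. norm (qpoch_inf x q) > 1/2) (nhds 0)"
    by (rule order_tendstoD) simp
  then obtain r where r: "r > 0" "\<And>x. norm x < r \<Longrightarrow> norm (qpoch_inf x q) > 1/2"
    by (auto simp: eventually_nhds_metric dist_norm)
  show ?thesis
  proof (rule that[OF r(1)])
    fix x :: complex assume "norm x < r"
    from r(2)[OF this] have "1/2 < norm (qpoch_inf x q)" .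
    moreover from this have "inverse (norm (qpoch_inf x q)) \<le> inverse (1/2)"
      by (intro le_imp_inverse_le) auto
    ultimately show "qpoch_inf x q \<noteq> 0 \<and> norm (inverse (qpoch_inf x q)) \<le> 2"
      by (auto simp: norm_inverse)
  qed
qed

section \<open>The q-binomial theorem\<close>

lemma summable_q_binomial:
  assumes "norm z < 1"
  shows "summable (\<lambda>m. norm (qpoch x q m / qpoch q q m * z ^ m))"
proof -
  obtain M where M: "M > 0" "\<And>n. norm (inverse (qpoch q q n)) \<le> M"
    using bounded_inverse_qpoch_q by blast
  define N where "N = exp (norm x / (1 - norm q))"
  have N: "N > 0" "\<And>n. norm (qpoch x q n) \<le> N"
    by (simp_all add: N_def norm_qpoch_le)
  show ?thesis
  proof (rule summable_comparison_test')
    show "summable (\<lambda>m. N * M * norm z ^ m)"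
      using assms by (intro summable_mult summable_geometric) auto
    show "norm (norm (qpoch x q m / qpoch q q m * z ^ m)) \<le> N * M * norm z ^ m" if "m \<ge> 0" for m
      using M(1) N(1) M(2)[of m] N(2)[of m]
      by (simp add: divide_inverse norm_mult norm_power norm_inverse mult_mono)
  qed
qed

text \<open>
The recurrence of the coefficients says that the sum \<open>F\<close> of the series satisfies
\<open>(1 - y) F(y) = (1 - xy) F(yq)\<close>. Iterating this along \<open>z q^n\<close>, where \<open>F\<close> tends to \<open>F(0) = 1\<close>, produces
the two infinite products.
\<close>

lemma q_binomial:
  assumes "norm z < 1"
  shows "(\<lambda>m. qpoch x q m / qpoch q q m * z ^ m) sums (qpoch_inf (x * z) q / qpoch_inf z q)"
proof -
  define A where "A m = qpoch x q m / qpoch q q m" for m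
  define F where "F y = (\<Sum>m. A m * y ^ m)" for y
  have summ: "summable (\<lambda>m. A m * y ^ m)" if "norm y < 1" for y
    using summable_q_binomial[OF that, of x] unfolding A_def by (rule summable_norm_cancel)
  have A_Suc: "A (Suc m) * (1 - q ^ Suc m) = A m * (1 - x * q ^ m)" for m
  proof -
    have "1 - q * q ^ m \<noteq> 0"
      using qpoch_q_nonzero[of "Suc m"] by (simp add: qpoch_Suc)
    then show ?thesis
      by (simp add: A_def qpoch_Suc)
  qed
  have step: "(1 - y) * F y = (1 - x * y) * F (y * q)" if y: "norm y < 1" for y
  proof -
    have yq: "norm (y * q) < 1"
      using mult_strict_mono[OF y norm_q] norm_q by (simp add: norm_mult)
    have "(\<lambda>m. A (Suc m) * y ^ Suc m) sums (F y - A 0)"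
      using summable_sums[OF summ[OF y]] unfolding F_def by (subst sums_Suc_iff) simp
    moreover have "(\<lambda>m. y * (A m * y ^ m)) sums (y * F y)"
      using summable_sums[OF summ[OF y]] unfolding F_def by (rule sums_mult)
    ultimately have l: "(\<lambda>m. A (Suc m) * y ^ Suc m - y * (A m * y ^ m)) sums (F y - A 0 - y * F y)"
      by (rule sums_diff)
    have "(\<lambda>m. A (Suc m) * (y * q) ^ Suc m) sums (F (y * q) - A 0)"
      using summable_sums[OF summ[OF yq]] unfolding F_def by (subst sums_Suc_iff) simp
    moreover have "(\<lambda>m. (x * y) * (A m * (y * q) ^ m)) sums ((x * y) * F (y * q))"
      using summable_sums[OF summ[OF yq]] unfolding F_def by (rule sums_mult)
    ultimately have r: "(\<lambda>m. A (Suc m) * (y * q) ^ Suc m - (x * y) * (A m * (y * q) ^ m))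
        sums (F (y * q) - A 0 - x * y * F (y * q))"
      by (rule sums_diff)
    have "A (Suc m) * y ^ Suc m - y * (A m * y ^ m)
        = A (Suc m) * (y * q) ^ Suc m - (x * y) * (A m * (y * q) ^ m)" for m
    proof -
      have "A (Suc m) * y ^ Suc m - y * (A m * y ^ m)
          - (A (Suc m) * (y * q) ^ Suc m - (x * y) * (A m * (y * q) ^ m))
          = y ^ Suc m * (A (Suc m) * (1 - q ^ Suc m) - A m * (1 - x * q ^ m))"
        by (simp add: algebra_simps power_mult_distrib)
      then show ?thesis
        using A_Suc by simp
    qed
    with l r have "F y - A 0 - y * F y = F (y * q) - A 0 - x * y * F (y * q)"
      by (simp add: sums_iff)
    then show ?thesis
      by (simp add: algebra_simps)
  qed
  have iter: "qpoch z q n * F z = qpoch (x * z) q n * F (z * q ^ n)" for n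
  proof (induction n)
    case (Suc n)
    have "norm (z * q ^ n) \<le> norm z * 1"
      unfolding norm_mult norm_power using norm_q by (intro mult_left_mono power_le_one) auto
    then have "norm (z * q ^ n) < 1"
      using assms by simp
    note IH = Suc and st = step[OF this]
    have "qpoch z q (Suc n) * F z = (1 - z * q ^ n) * (qpoch z q n * F z)"
      by (simp add: qpoch_Suc)
    also have "\<dots> = qpoch (x * z) q n * ((1 - z * q ^ n) * F (z * q ^ n))"
      unfolding IH by (simp only: mult_ac)
    also have "\<dots> = qpoch (x * z) q (Suc n) * F (z * q ^ Suc n)"
      unfolding st by (simp add: qpoch_Suc mult_ac)
    finally show ?case .
  qed simp
  have "(F \<longlongrightarrow> A 0) (at 0)"
    using powser_limit_0[of 1 A F] summ unfolding F_def by (auto simp: summable_sums)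
  then have "isCont F 0"
    by (simp add: isCont_def F_def powser_zero[of A])
  then have "(\<lambda>n. F (z * q ^ n)) \<longlonglongrightarrow> F 0"
    by (rule isCont_tendsto_compose) (rule tendsto_mult_power_q)
  then have "(\<lambda>n. qpoch (x * z) q n * F (z * q ^ n)) \<longlonglongrightarrow> qpoch_inf (x * z) q * F 0"
    by (intro tendsto_mult qpoch_inf_LIMSEQ norm_q)
  moreover have "(\<lambda>n. qpoch z q n * F z) \<longlonglongrightarrow> qpoch_inf z q * F z"
    by (intro tendsto_mult qpoch_inf_LIMSEQ norm_q tendsto_const)
  ultimately have "qpoch_inf z q * F z = qpoch_inf (x * z) q * F 0"
    unfolding iter by (metis LIMSEQ_unique)
  moreover have "F 0 = A 0"
    by (simp add: F_def powser_zero[of A])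
  then have "F 0 = 1"
    by (simp add: A_def)
  ultimately have "F z = qpoch_inf (x * z) q / qpoch_inf z q"
    using qpoch_inf_nonzero_small[OF assms] by (simp add: field_simps)
  then show ?thesis
    using summable_sums[OF summ[OF assms]] by (simp add: F_def A_def)
qed

section \<open>The q-difference equation of the kernel\<close>

lemma one_minus_q_power_nonzero: "1 - q * q ^ n \<noteq> 0"
  using qpoch_q_nonzero[of "Suc n"] by (simp add: qpoch_Suc)

lemma qdiff_kernel_0:
  "qdiff_kernel q 0 a s r u = qpoch_inf (a * r * u) q / qpoch_inf (a * s) q"
  by (simp add: qdiff_kernel_def)

text \<open>
Divided by \<open>(ar)\<^sub>\<infinity>\<close>, this says that \<open>D\<close> maps the normalised kernel of index \<open>k\<close> to \<open>1 - q^(k+1)\<close> times that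
of index \<open>k + 1\<close>. Each summand \<open>X j m\<close> with \<open>j + m = k\<close> contributes to the indices \<open>(j+1, m)\<close> and
\<open>(j, m+1)\<close>, the latter with weight \<open>q^j\<close>. Splitting
\<open>1 - q^(k+1) = (1 - q^j) + q^j (1 - q^(k+1-j))\<close>, which is Pascal's rule for q-binomial coefficients, matches
the two contributions.
\<close>

lemma qdiff_kernel_step:
  assumes "qpoch_inf (a * s) q \<noteq> 0"
  shows "qdiff_kernel q k a s r u - (1 - a * r) * qdiff_kernel q k (a * q) s r u
       = a * (1 - q ^ Suc k) * qdiff_kernel q (Suc k) a s r u"
proof -
  define X where "X j m b = r ^ j * s ^ m * qpoch u q j
      * (qpoch_inf (b * r * u * q ^ j) q / qpoch_inf (b * s * q ^ j) q)" for j m b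
  define w where "w j = (1::complex) / qpoch q q j" for j
  have Z: "qdiff_kernel q k b s r u = (\<Sum>j\<le>k. X j (k - j) b * w j * w (k - j))" for k b
    by (simp add: qdiff_kernel_def X_def w_def mult.assoc)
  have w_Suc: "(1 - q ^ Suc j) * w (Suc j) = w j" for j
    using one_minus_q_power_nonzero[of j] by (simp add: w_def qpoch_Suc)
  have X_step: "X j m a - (1 - a * r) * X j m (a * q) = a * (X (Suc j) m a + q ^ j * X j (Suc m) a)" for j m
  proof -
    define N D where "N = qpoch_inf (a * r * u * q ^ Suc j) q" and "D = qpoch_inf (a * s * q ^ Suc j) q"
    have D: "qpoch_inf (a * s * q ^ j) q = (1 - a * s * q ^ j) * D"
      using qpoch_inf_step[of "a * s * q ^ j"] by (simp add: D_def mult_ac)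
    have N: "qpoch_inf (a * r * u * q ^ j) q = (1 - a * r * u * q ^ j) * N"
      using qpoch_inf_step[of "a * r * u * q ^ j"] by (simp add: N_def mult_ac)
    have nz: "1 - a * s * q ^ j \<noteq> 0" "D \<noteq> 0"
      using qpoch_inf_shift_nonzero[OF assms, of j] by (auto simp: D)
    have shifted: "qpoch_inf (a * q * r * u * q ^ j) q = N" "qpoch_inf (a * q * s * q ^ j) q = D"
      by (simp_all add: N_def D_def mult_ac)
    \<comment> \<open>The common factor of all four summands, with \<open>(asq^j)\<^sub>\<infinity>\<close> as denominator.\<close>
    define B where "B = r ^ j * s ^ m * qpoch u q j * (N / ((1 - a * s * q ^ j) * D))"
    have "X j m a = (1 - a * r * u * q ^ j) * B"
      unfolding X_def N D B_def by simp
    moreover have "X j m (a * q) = (1 - a * s * q ^ j) * B"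
      unfolding X_def shifted B_def using nz by simp
    moreover have "X (Suc j) m a = r * (1 - u * q ^ j) * (1 - a * s * q ^ j) * B"
      unfolding X_def N_def[symmetric] D_def[symmetric] B_def using nz by (simp add: qpoch_Suc)
    moreover have "X j (Suc m) a = s * (1 - a * r * u * q ^ j) * B"
      unfolding X_def N D B_def by simp
    ultimately show ?thesis
      by (simp only:) (simp add: algebra_simps)
  qed
  have "(1 - q ^ Suc k) * qdiff_kernel q (Suc k) a s r u
      = (\<Sum>j\<le>Suc k. ((1 - q ^ j) + q ^ j * (1 - q ^ (Suc k - j))) * (X j (Suc k - j) a * w j * w (Suc k - j)))"
    unfolding Z sum_distrib_left
  proof (intro sum.cong refl)
    fix j assume "j \<in> {..Suc k}"
    then have "q ^ Suc k = q ^ j * q ^ (Suc k - j)"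
      by (simp flip: power_add)
    then show "(1 - q ^ Suc k) * (X j (Suc k - j) a * w j * w (Suc k - j))
      = ((1 - q ^ j) + q ^ j * (1 - q ^ (Suc k - j))) * (X j (Suc k - j) a * w j * w (Suc k - j))"
      by (simp add: algebra_simps)
  qed
  also have "\<dots> = (\<Sum>j\<le>Suc k. (1 - q ^ j) * w j * X j (Suc k - j) a * w (Suc k - j))
      + (\<Sum>j\<le>Suc k. q ^ j * X j (Suc k - j) a * w j * ((1 - q ^ (Suc k - j)) * w (Suc k - j)))"
    unfolding sum.distrib[symmetric] by (intro sum.cong refl) (simp add: algebra_simps)
  also have "(\<Sum>j\<le>Suc k. (1 - q ^ j) * w j * X j (Suc k - j) a * w (Suc k - j))
      = (\<Sum>j\<le>k. X (Suc j) (k - j) a * w j * w (k - j))"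
    unfolding sum.atMost_Suc_shift w_Suc by (simp add: mult_ac)
  also have "(\<Sum>j\<le>Suc k. q ^ j * X j (Suc k - j) a * w j * ((1 - q ^ (Suc k - j)) * w (Suc k - j)))
      = (\<Sum>j\<le>k. q ^ j * X j (Suc k - j) a * w j * ((1 - q ^ Suc (k - j)) * w (Suc (k - j))))"
    by (simp add: Suc_diff_le)
  also have "\<dots> = (\<Sum>j\<le>k. q ^ j * X j (Suc (k - j)) a * w j * w (k - j))"
    unfolding w_Suc by (intro sum.cong refl) (simp add: Suc_diff_le)
  finally have "(1 - q ^ Suc k) * qdiff_kernel q (Suc k) a s r u
      = (\<Sum>j\<le>k. X (Suc j) (k - j) a * w j * w (k - j))
        + (\<Sum>j\<le>k. q ^ j * X j (Suc (k - j)) a * w j * w (k - j))" .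
  then have "a * ((1 - q ^ Suc k) * qdiff_kernel q (Suc k) a s r u)
      = (\<Sum>j\<le>k. a * (X (Suc j) (k - j) a + q ^ j * X j (Suc (k - j)) a) * w j * w (k - j))"
    unfolding sum.distrib[symmetric] sum_distrib_left
    by (simp only: sum_distrib_left) (intro sum.cong refl, simp add: algebra_simps)
  also have "\<dots> = (\<Sum>j\<le>k. (X j (k - j) a - (1 - a * r) * X j (k - j) (a * q)) * w j * w (k - j))"
    unfolding X_step ..
  also have "\<dots> = qdiff_kernel q k a s r u - (1 - a * r) * qdiff_kernel q k (a * q) s r u"
    unfolding Z sum_distrib_left sum_subtractf[symmetric]
    by (intro sum.cong refl) (simp add: algebra_simps)
  finally show ?thesis
    by (simp add: mult.assoc)
qed

lemma norm_mult_power_q_le: "norm (y * q ^ n) \<le> norm y"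
  using norm_q by (simp add: norm_mult norm_power mult_left_le power_le_one)

text \<open>
A bound that is uniform in \<open>a\<close>, \<open>s\<close> and \<open>u\<close>: it serves both for dominating sums over the orbit
\<open>s = x q^n\<close> and for letting \<open>a\<close> tend to 0. The remaining sum over \<open>j\<close> is a convolution of two geometric
sequences, so it stays summable after multiplication by \<open>\<bar>g\<bar>^k\<close> when \<open>\<bar>gr\<bar> < 1\<close> and \<open>\<bar>g\<bar>S < 1\<close>.
\<close>

lemma qdiff_kernel_bound:
  assumes "U \<ge> 0" "R \<ge> 0"
  shows "\<exists>M>0. \<forall>k a s u. norm s \<le> S \<longrightarrow> norm u \<le> U \<longrightarrow> norm (a * r * u) \<le> R \<longrightarrow>
        (\<forall>j. norm (inverse (qpoch_inf (a * s * q ^ j) q)) \<le> L) \<longrightarrow>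
        norm (qdiff_kernel q k a s r u) \<le> M * (\<Sum>j\<le>k. norm r ^ j * S ^ (k - j))"
proof -
  obtain M1 where M1: "M1 > 0" "\<And>y n. norm y \<le> U \<Longrightarrow> norm (qpoch y q n) \<le> M1"
    using bounded_qpoch[OF assms(1)] by metis
  obtain M2 where M2: "M2 > 0" "\<And>y. norm y \<le> R \<Longrightarrow> norm (qpoch_inf y q) \<le> M2"
    using bounded_qpoch[OF assms(2)] by metis
  obtain M3 where M3: "M3 > 0" "\<And>n. norm (inverse (qpoch q q n)) \<le> M3"
    using bounded_inverse_qpoch_q by metis
  \<comment> \<open>The absolute value and the summand 1 make \<open>M\<close> positive whatever \<open>L\<close> is, even if no \<open>s\<close> satisfies the hypotheses.\<close>
  define M where "M = M1 * M2 * \<bar>L\<bar> * M3 * M3 + 1"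
  show ?thesis
  proof (intro exI[of _ M] conjI allI impI)
    show "M > 0"
      using M1(1) M2(1) M3(1) by (simp add: M_def add_nonneg_pos)
    fix k and a s u :: complex
    assume s: "norm s \<le> S" and u: "norm u \<le> U" and aru: "norm (a * r * u) \<le> R"
      and L: "\<forall>j. norm (inverse (qpoch_inf (a * s * q ^ j) q)) \<le> L"
    have S: "S \<ge> 0" and L0: "L \<ge> 0"
      using s L norm_ge_zero order_trans by blast+
    have M2': "norm (qpoch_inf (a * r * u * q ^ j) q) \<le> M2" for j
      using M2(2) norm_mult_power_q_le aru order_trans by blast
    show "norm (qdiff_kernel q k a s r u) \<le> M * (\<Sum>j\<le>k. norm r ^ j * S ^ (k - j))"
      unfolding qdiff_kernel_def sum_distrib_left
    proof (rule sum_norm_le)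
      fix j
      have "norm (r ^ j * s ^ (k - j) * qpoch u q j
          * (qpoch_inf (a * r * u * q ^ j) q / qpoch_inf (a * s * q ^ j) q)
          / (qpoch q q j * qpoch q q (k - j)))
        = (norm r ^ j * norm s ^ (k - j)) * (norm (qpoch u q j)
          * norm (qpoch_inf (a * r * u * q ^ j) q) * norm (inverse (qpoch_inf (a * s * q ^ j) q))
          * norm (inverse (qpoch q q j)) * norm (inverse (qpoch q q (k - j))))"
        by (simp add: divide_inverse norm_mult norm_power norm_inverse mult_ac)
      also have "\<dots> \<le> (norm r ^ j * S ^ (k - j)) * (M1 * M2 * L * M3 * M3)"
        using s S L0 M1 M2' M2(1) M3 L u
        by (intro mult_mono power_mono mult_nonneg_nonneg zero_le_power) (auto intro: less_imp_le)
      also have "\<dots> \<le> (norm r ^ j * S ^ (k - j)) * M"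
        using S L0 by (intro mult_left_mono) (auto simp: M_def)
      finally show "norm (r ^ j * s ^ (k - j) * qpoch u q j
          * (qpoch_inf (a * r * u * q ^ j) q / qpoch_inf (a * s * q ^ j) q)
          / (qpoch q q j * qpoch q q (k - j))) \<le> M * (norm r ^ j * S ^ (k - j))"
        by (simp only: mult_ac)
    qed
  qed
qed

lemma tendsto_qdiff_kernel:
  assumes "(h \<longlongrightarrow> 0) F"
  shows "((\<lambda>i. qdiff_kernel q k (h i) s r u) \<longlongrightarrow> qdiff_kernel q k 0 s r u) F"
proof -
  have lim: "((\<lambda>i. qpoch_inf (h i * x) q) \<longlongrightarrow> 1) F" for x
    by (intro tendsto_qpoch_inf_0 tendsto_mult_left_zero assms)
  have ratio: "((\<lambda>i. qpoch_inf (h i * r * u * q ^ j) q / qpoch_inf (h i * s * q ^ j) q) \<longlongrightarrow> 1) F" for j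
    using tendsto_divide[OF lim[of "r * u * q ^ j"] lim[of "s * q ^ j"]] by (simp add: mult.assoc)
  have "((\<lambda>i. qdiff_kernel q k (h i) s r u)
      \<longlongrightarrow> (\<Sum>j\<le>k. r ^ j * s ^ (k - j) * qpoch u q j * 1 / (qpoch q q j * qpoch q q (k - j)))) F"
    unfolding qdiff_kernel_def
    by (intro tendsto_sum tendsto_divide[OF tendsto_mult[OF tendsto_const ratio] tendsto_const]) simp
  then show ?thesis
    by (simp add: qdiff_kernel_def)
qed

lemma bounded_qdiff_kernel_orbit:
  assumes "qpoch_inf (a * x) q \<noteq> 0"
  obtains M where "M > 0"
    "\<And>k n. norm (qdiff_kernel q k a (x * q ^ n) r (e * (x * q ^ n))) \<le> M * (\<Sum>j\<le>k. norm r ^ j * norm x ^ (k - j))"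
proof -
  obtain L where L: "\<And>n. norm (inverse (qpoch_inf (a * x * q ^ n) q)) \<le> L"
    using bounded_inverse_orbit[OF assms] by metis
  obtain M where M: "M > 0"
    "\<And>k b s u. \<lbrakk>norm s \<le> norm x; norm u \<le> norm (e * x); norm (b * r * u) \<le> norm (a * r * e * x);
        \<And>j. norm (inverse (qpoch_inf (b * s * q ^ j) q)) \<le> L\<rbrakk>
      \<Longrightarrow> norm (qdiff_kernel q k b s r u) \<le> M * (\<Sum>j\<le>k. norm r ^ j * norm x ^ (k - j))"
    using qdiff_kernel_bound[OF norm_ge_zero[of "e * x"] norm_ge_zero[of "a * r * e * x"], of "norm x" r L]
    by blast
  show ?thesis
  proof (rule that[OF M(1)], rule M(2))
    fix n
    show "norm (x * q ^ n) \<le> norm x" "norm (e * (x * q ^ n)) \<le> norm (e * x)"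
      "norm (a * r * (e * (x * q ^ n))) \<le> norm (a * r * e * x)"
      using norm_mult_power_q_le[of x n] norm_mult_power_q_le[of "e * x" n]
        norm_mult_power_q_le[of "a * r * e * x" n] by (simp_all add: mult_ac)
    show "norm (inverse (qpoch_inf (a * (x * q ^ n) * q ^ j) q)) \<le> L" for j
      using L[of "n + j"] by (simp add: power_add mult_ac)
  qed
qed

section \<open>Jackson integrals\<close>

lemma summable_jackson:
  assumes "Bseq (\<lambda>n. F (x * q ^ n))"
  shows "summable (\<lambda>n. norm (F (x * q ^ n) * q ^ n))"
proof -
  obtain M where M: "\<And>n. norm (F (x * q ^ n)) \<le> M"
    using assms unfolding Bseq_def by blast
  show ?thesis
  proof (rule summable_comparison_test')
    show "summable (\<lambda>n. M * norm q ^ n)"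
      using norm_q by (intro summable_mult summable_geometric) auto
    show "norm (norm (F (x * q ^ n) * q ^ n)) \<le> M * norm q ^ n" if "n \<ge> 0" for n
      using M[of n] by (simp add: norm_mult norm_power mult_right_mono)
  qed
qed

lemma jackson0_linear:
  assumes "Bseq (\<lambda>n. F (x * q ^ n))" "Bseq (\<lambda>n. G (x * q ^ n))"
  shows "jackson0 q x (\<lambda>t. \<alpha> * F t + \<beta> * G t) = \<alpha> * jackson0 q x F + \<beta> * jackson0 q x G"
proof -
  note F = summable_norm_cancel[OF summable_jackson[OF assms(1)]]
  note G = summable_norm_cancel[OF summable_jackson[OF assms(2)]]
  have "(\<lambda>n. \<alpha> * (F (x * q ^ n) * q ^ n) + \<beta> * (G (x * q ^ n) * q ^ n)) sums
      (\<alpha> * (\<Sum>n. F (x * q ^ n) * q ^ n) + \<beta> * (\<Sum>n. G (x * q ^ n) * q ^ n))"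
    by (intro sums_add sums_mult summable_sums F G)
  then show ?thesis
    unfolding jackson0_def by (simp add: sums_iff algebra_simps)
qed

text \<open>
If \<open>t F(t)\<close> is the difference \<open>v(t) - v(qt)\<close>, then \<open>(1-q) v\<close> is a q-antiderivative of \<open>F\<close>. This is the
fundamental theorem of calculus for the Jackson integral.
\<close>

lemma jackson0_telescope:
  assumes "x \<noteq> 0" and step: "\<And>n. x * q ^ n * F (x * q ^ n) = v (x * q ^ n) - v (x * q ^ Suc n)"
    and lim: "(\<lambda>n. v (x * q ^ n)) \<longlonglongrightarrow> L"
  shows "jackson0 q x F = (1 - q) * (v x - L)"
proof -
  have "(\<lambda>n. v (x * q ^ n) - v (x * q ^ Suc n)) sums (v (x * q ^ 0) - L)"
    by (rule telescope_sums'[OF lim])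
  then have "(\<lambda>n. x * q ^ n * F (x * q ^ n)) sums (v x - L)"
    unfolding step by simp
  then have "(\<lambda>n. (x * q ^ n * F (x * q ^ n)) / x) sums ((v x - L) / x)"
    by (rule sums_divide)
  moreover have "(x * q ^ n * F (x * q ^ n)) / x = F (x * q ^ n) * q ^ n" for n
    using assms(1) by simp
  ultimately show ?thesis
    using assms(1) by (simp add: jackson0_def sums_iff)
qed

text \<open>
By Tannery's theorem. Near \<open>a = 0\<close> all factors \<open>1/(a x q^i)\<^sub>\<infinity>\<close> are bounded by 2, whatever \<open>i\<close> is, so the
kernels are bounded uniformly along the orbit of \<open>x\<close>.
\<close>

lemma isCont_jackson0_qdiff_kernel:
  assumes W: "Bseq (\<lambda>n. W (x * q ^ n))"
  shows "isCont (\<lambda>a. jackson0 q x (\<lambda>t. W t * qdiff_kernel q k a t r (e * t))) 0"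
proof -
  obtain K where K: "K > 0" "\<And>n. norm (W (x * q ^ n)) \<le> K"
    using W unfolding Bseq_def by blast
  obtain \<rho> where \<rho>: "\<rho> > 0" "\<And>y. norm y < \<rho> \<Longrightarrow> qpoch_inf y q \<noteq> 0 \<and> norm (inverse (qpoch_inf y q)) \<le> 2"
    using bounded_inverse_near_0 by blast
  obtain M where M: "M > 0"
    "\<And>k a s u. \<lbrakk>norm s \<le> norm x; norm u \<le> norm (e * x); norm (a * r * u) \<le> 1;
        \<And>j. norm (inverse (qpoch_inf (a * s * q ^ j) q)) \<le> 2\<rbrakk>
      \<Longrightarrow> norm (qdiff_kernel q k a s r u) \<le> M * (\<Sum>j\<le>k. norm r ^ j * norm x ^ (k - j))"
    using qdiff_kernel_bound[OF norm_ge_zero[of "e * x"] zero_le_one, of "norm x" r 2]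
    by blast
  define C where "C = K * (M * (\<Sum>j\<le>k. norm r ^ j * norm x ^ (k - j)))"
  have small: "eventually (\<lambda>a. norm (a * y) < \<epsilon>) (at 0)" if "\<epsilon> > 0" for y :: complex and \<epsilon>
  proof -
    have "((\<lambda>a. norm (a * y)) \<longlongrightarrow> norm (0 * y)) (at 0)"
      by (intro tendsto_intros)
    then show ?thesis
      using that by (intro order_tendstoD) auto
  qed
  have bound: "norm (W (x * q ^ n) * qdiff_kernel q k a (x * q ^ n) r (e * (x * q ^ n)) * q ^ n) \<le> C * norm q ^ n"
    if a: "norm (a * x) < \<rho>" "norm (a * (r * e * x)) < 1" for a n
  proof -
    have "norm (qdiff_kernel q k a (x * q ^ n) r (e * (x * q ^ n))) \<le> M * (\<Sum>j\<le>k. norm r ^ j * norm x ^ (k - j))"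
    proof (rule M(2))
      show "norm (x * q ^ n) \<le> norm x" "norm (e * (x * q ^ n)) \<le> norm (e * x)"
        "norm (a * r * (e * (x * q ^ n))) \<le> 1"
        using norm_mult_power_q_le[of x n] norm_mult_power_q_le[of "e * x" n]
          norm_mult_power_q_le[of "a * (r * e * x)" n] a(2) by (simp_all add: mult_ac)
      have "norm (a * (x * q ^ n) * q ^ j) < \<rho>" for j
        using norm_mult_power_q_le[of "a * x" "n + j"] a(1) by (simp add: power_add mult_ac)
      then show "norm (inverse (qpoch_inf (a * (x * q ^ n) * q ^ j) q)) \<le> 2" for j
        using \<rho>(2) by blast
    qed
    with K M(1) show ?thesis
      unfolding norm_mult norm_power C_def
      by (intro mult_mono mult_nonneg_nonneg sum_nonneg) (auto intro: less_imp_le)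
  qed
  have "eventually (\<lambda>a. \<forall>n. norm (W (x * q ^ n) * qdiff_kernel q k a (x * q ^ n) r (e * (x * q ^ n)) * q ^ n)
      \<le> C * norm q ^ n) (at 0)"
    using small[OF \<rho>(1), of x] small[OF zero_less_one, of "r * e * x"]
    by eventually_elim (use bound in blast)
  then have ev: "eventually (\<lambda>(n, a). norm (W (x * q ^ n) * qdiff_kernel q k a (x * q ^ n) r (e * (x * q ^ n)) * q ^ n)
      \<le> C * norm q ^ n) (at_top \<times>\<^sub>F at 0)"
    unfolding eventually_prod_filter
    by (intro exI[of _ "\<lambda>_. True"] exI[of _ "\<lambda>a. \<forall>n. norm (W (x * q ^ n) * qdiff_kernel q k a (x * q ^ n) r (e * (x * q ^ n)) * q ^ n)
      \<le> C * norm q ^ n"]) auto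
  have "((\<lambda>a. \<Sum>n. W (x * q ^ n) * qdiff_kernel q k a (x * q ^ n) r (e * (x * q ^ n)) * q ^ n)
      \<longlongrightarrow> (\<Sum>n. W (x * q ^ n) * qdiff_kernel q k 0 (x * q ^ n) r (e * (x * q ^ n)) * q ^ n)) (at 0)"
  proof (rule tannerys_theorem[THEN conjunct2, THEN conjunct2, OF _ ev])
    show "((\<lambda>a. W (x * q ^ n) * qdiff_kernel q k a (x * q ^ n) r (e * (x * q ^ n)) * q ^ n)
      \<longlongrightarrow> W (x * q ^ n) * qdiff_kernel q k 0 (x * q ^ n) r (e * (x * q ^ n)) * q ^ n) (at 0)" for n
      by (intro tendsto_intros tendsto_qdiff_kernel)
    show "summable (\<lambda>n. C * norm q ^ n)"
      using norm_q by (intro summable_mult summable_geometric) auto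
  qed simp
  then show ?thesis
    unfolding isCont_def jackson0_def by (intro tendsto_intros)
qed

section \<open>The q-beta integral\<close>

lemma tendsto_qpoch_inf_orbit: "(\<lambda>n. qpoch_inf (y * (x * q ^ n)) q) \<longlonglongrightarrow> 1"
  using tendsto_qpoch_inf_0[OF tendsto_mult_power_q[of "y * x"]] by (simp add: mult.assoc)

lemma tendsto_qpoch_inf_orbit_divide: "(\<lambda>n. qpoch_inf (p * (x * q ^ n) / y) q) \<longlonglongrightarrow> 1"
  using tendsto_qpoch_inf_orbit[of "p / y" x] by simp

lemma qpoch_inf_orbit_nonzero: "qpoch_inf (y * x) q \<noteq> 0 \<Longrightarrow> qpoch_inf (y * (x * q ^ n)) q \<noteq> 0"
  using qpoch_inf_shift_nonzero[of "y * x" n] by (simp add: mult.assoc)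

definition qbeta :: "complex \<Rightarrow> complex \<Rightarrow> complex \<Rightarrow> complex \<Rightarrow> complex \<Rightarrow> complex" where
  "qbeta a b c d e = jackson q c d (\<lambda>t. qpoch_inf (q * t / c) q * qpoch_inf (q * t / d) q
     * qpoch_inf (a * b * c * d * e * t) q / (qpoch_inf (a * t) q * qpoch_inf (b * t) q * qpoch_inf (e * t) q))"

lemma qbeta_swap: "qbeta a b c d e = qbeta b a c d e" "qbeta a b c d e = qbeta e b c d a"
  by (simp_all add: qbeta_def mult_ac)

text \<open>
The combination of the two integrands has the q-antiderivative \<open>(1-q) v\<close>, where
\<open>v(t) = acd (t/c, t/d, abcdet)\<^sub>\<infinity> / (at, bt, et)\<^sub>\<infinity>\<close>. It vanishes at both endpoints, because \<open>(1)\<^sub>\<infinity> = 0\<close>,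
and tends to \<open>acd\<close> along each orbit. Hence both endpoints give the same value, and the contributions cancel
in the integral from \<open>c\<close> to \<open>d\<close>.
\<close>

lemma qbeta_shift_half:
  assumes x: "x = c \<or> x = d" and nz: "c \<noteq> 0" "d \<noteq> 0"
    and ax: "qpoch_inf (a * x) q \<noteq> 0" and bx: "qpoch_inf (b * x) q \<noteq> 0" and ex: "qpoch_inf (e * x) q \<noteq> 0"
  defines "F \<equiv> \<lambda>a t. qpoch_inf (q * t / c) q * qpoch_inf (q * t / d) q * qpoch_inf (a * b * c * d * e * t) q
     / (qpoch_inf (a * t) q * qpoch_inf (b * t) q * qpoch_inf (e * t) q)"
  shows "(1 - a * c) * (1 - a * d) * jackson0 q x (F a)
       - (1 - a * b * c * d) * (1 - a * c * d * e) * jackson0 q x (F (a * q)) = - (1 - q) * (a * c * d)"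
proof -
  define \<alpha> \<beta> where "\<alpha> = (1 - a * c) * (1 - a * d)" and "\<beta> = (1 - a * b * c * d) * (1 - a * c * d * e)"
  define v where "v t = a * c * d * (qpoch_inf (t / c) q * qpoch_inf (t / d) q * qpoch_inf (a * b * c * d * e * t) q
     / (qpoch_inf (a * t) q * qpoch_inf (b * t) q * qpoch_inf (e * t) q))" for t
  have Bseq_F: "Bseq (\<lambda>n. F a' (x * q ^ n))" for a'
  proof -
    have "(\<lambda>n. F a' (x * q ^ n)) \<longlonglongrightarrow> 1 * 1 * 1 / (1 * 1 * 1)"
      unfolding F_def
      by (intro tendsto_divide tendsto_mult tendsto_qpoch_inf_orbit tendsto_qpoch_inf_orbit_divide) auto
    then show ?thesis
      by (intro convergent_imp_Bseq convergentI)
  qed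
  have "jackson0 q x (\<lambda>t. \<alpha> * F a t + (- \<beta>) * F (a * q) t) = (1 - q) * (v x - a * c * d)"
  proof (rule jackson0_telescope)
    show "x \<noteq> 0"
      using x nz by auto
    have "(\<lambda>n. v (x * q ^ n)) \<longlonglongrightarrow> a * c * d * (1 * 1 * 1 / (1 * 1 * 1))"
      unfolding v_def
      by (intro tendsto_divide tendsto_mult tendsto_const tendsto_qpoch_inf_orbit
          tendsto_qpoch_inf_orbit_divide[of 1, simplified]) auto
    then show "(\<lambda>n. v (x * q ^ n)) \<longlonglongrightarrow> a * c * d"
      by simp
    fix n
    define t where "t = x * q ^ n"
    have nz': "qpoch_inf (a * t) q \<noteq> 0" "qpoch_inf (b * t) q \<noteq> 0" "qpoch_inf (e * t) q \<noteq> 0"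
      unfolding t_def using ax bx ex by (simp_all add: qpoch_inf_orbit_nonzero)
    define A B E P Q N where "A = qpoch_inf (a * t * q) q" and "B = qpoch_inf (b * t * q) q"
      and "E = qpoch_inf (e * t * q) q" and "P = qpoch_inf (q * t / c) q" and "Q = qpoch_inf (q * t / d) q"
      and "N = qpoch_inf (a * b * c * d * e * t * q) q"
    have steps: "qpoch_inf (a * t) q = (1 - a * t) * A" "qpoch_inf (b * t) q = (1 - b * t) * B"
      "qpoch_inf (e * t) q = (1 - e * t) * E" "qpoch_inf (t / c) q = (1 - t / c) * P"
      "qpoch_inf (t / d) q = (1 - t / d) * Q"
      "qpoch_inf (a * b * c * d * e * t) q = (1 - a * b * c * d * e * t) * N"
      unfolding A_def B_def E_def P_def Q_def N_def
      by (subst qpoch_inf_step, simp add: mult_ac)+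
    have shifted: "qpoch_inf (a * q * t) q = A" "qpoch_inf (a * (t * q)) q = A" "qpoch_inf (b * (t * q)) q = B"
       "qpoch_inf (e * (t * q)) q = E" "qpoch_inf (t * q / c) q = P" "qpoch_inf (t * q / d) q = Q"
       "qpoch_inf (a * q * b * c * d * e * t) q = N" "qpoch_inf (a * b * c * d * e * (t * q)) q = N"
      unfolding A_def B_def E_def P_def Q_def N_def by (simp_all add: mult_ac)
    have nz'': "1 - a * t \<noteq> 0" "1 - b * t \<noteq> 0" "1 - e * t \<noteq> 0" "A \<noteq> 0" "B \<noteq> 0" "E \<noteq> 0"
      using nz' unfolding steps by auto
    \<comment> \<open>The common factor of \<open>F a t\<close>, \<open>F (a * q) t\<close>, \<open>v t\<close> and \<open>v (t * q)\<close>. What remains is a polynomial identity in \<open>t\<close>.\<close>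
    define H where "H = P * Q * N / ((1 - a * t) * A * ((1 - b * t) * B) * ((1 - e * t) * E))"
    have Fa: "F a t = (1 - a * b * c * d * e * t) * H"
      unfolding F_def steps H_def P_def[symmetric] Q_def[symmetric] by simp
    have Faq: "F (a * q) t = (1 - a * t) * H"
      unfolding F_def shifted steps(2,3) H_def P_def[symmetric] Q_def[symmetric] using nz'' by (simp add: mult_ac)
    have "v t = (a * c * d * (1 - t / c) * (1 - t / d)) * (1 - a * b * c * d * e * t) * H"
      unfolding v_def steps H_def by simp
    also have "a * c * d * (1 - t / c) * (1 - t / d) = a * (c - t) * (d - t)"
      using nz by (simp add: field_simps)
    finally have vt: "v t = a * (c - t) * (d - t) * (1 - a * b * c * d * e * t) * H" .
    have vtq: "v (t * q) = a * c * d * (1 - a * t) * (1 - b * t) * (1 - e * t) * H"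
      unfolding v_def shifted H_def using nz'' by (simp add: mult_ac)
    have "t * (\<alpha> * (1 - a * b * c * d * e * t) - \<beta> * (1 - a * t))
        = a * (c - t) * (d - t) * (1 - a * b * c * d * e * t) - a * c * d * (1 - a * t) * (1 - b * t) * (1 - e * t)"
      unfolding \<alpha>_def \<beta>_def by algebra
    then have "t * (\<alpha> * F a t + (- \<beta>) * F (a * q) t) = v t - v (t * q)"
      unfolding Fa Faq vt vtq by algebra
    then show "x * q ^ n * (\<alpha> * F a (x * q ^ n) + (- \<beta>) * F (a * q) (x * q ^ n))
        = v (x * q ^ n) - v (x * q ^ Suc n)"
      by (simp add: t_def mult_ac)
  qed
  moreover have "v x = 0"
    using x nz by (auto simp: v_def)
  ultimately show ?thesis
    unfolding jackson0_linear[OF Bseq_F Bseq_F] \<alpha>_def \<beta>_def by (simp add: algebra_simps)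
qed

lemma qbeta_shift:
  assumes "c \<noteq> 0" "d \<noteq> 0"
    and "qpoch_inf (a * c) q \<noteq> 0" "qpoch_inf (b * c) q \<noteq> 0" "qpoch_inf (e * c) q \<noteq> 0"
    and "qpoch_inf (a * d) q \<noteq> 0" "qpoch_inf (b * d) q \<noteq> 0" "qpoch_inf (e * d) q \<noteq> 0"
  shows "(1 - a * c) * (1 - a * d) * qbeta a b c d e
       = (1 - a * b * c * d) * (1 - a * c * d * e) * qbeta (a * q) b c d e"
proof -
  have combine: "\<alpha> * (D - C) = \<beta> * (D' - C')"
    if "\<alpha> * D - \<beta> * D' = K" "\<alpha> * C - \<beta> * C' = K" for \<alpha> \<beta> C C' D D' K :: complex
  proof -
    have "\<alpha> * D = K + \<beta> * D'" "\<alpha> * C = K + \<beta> * C'"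
      using that by (simp_all add: diff_eq_eq)
    then show ?thesis
      by (simp add: right_diff_distrib)
  qed
  show ?thesis
    unfolding qbeta_def jackson_def
    by (rule combine) (rule qbeta_shift_half; use assms in simp)+
qed

text \<open>
The part of the integrand that does not depend on \<open>a\<close>.
\<close>

definition qbeta_weight :: "complex \<Rightarrow> complex \<Rightarrow> complex \<Rightarrow> complex \<Rightarrow> complex \<Rightarrow> complex" where
  "qbeta_weight b c d e t = qpoch_inf (q * t / c) q * qpoch_inf (q * t / d) q
     / (qpoch_inf (b * t) q * qpoch_inf (e * t) q)"

definition kernel_integral :: "nat \<Rightarrow> complex \<Rightarrow> complex \<Rightarrow> complex \<Rightarrow> complex \<Rightarrow> complex \<Rightarrow> complex" where
  "kernel_integral k a b c d e
     = jackson q c d (\<lambda>t. qbeta_weight b c d e t * qdiff_kernel q k a t (b * c * d) (e * t))"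

lemma Bseq_qbeta_weight: "Bseq (\<lambda>n. qbeta_weight b c d e (x * q ^ n))"
proof -
  have "(\<lambda>n. qbeta_weight b c d e (x * q ^ n)) \<longlonglongrightarrow> 1 * 1 / (1 * 1)"
    unfolding qbeta_weight_def
    by (intro tendsto_divide tendsto_mult tendsto_qpoch_inf_orbit tendsto_qpoch_inf_orbit_divide) auto
  then show ?thesis
    by (intro convergent_imp_Bseq convergentI)
qed

lemma isCont_kernel_integral: "isCont (\<lambda>a. kernel_integral k a b c d e) 0"
  unfolding kernel_integral_def jackson_def
  by (intro continuous_intros isCont_jackson0_qdiff_kernel Bseq_qbeta_weight)

lemma kernel_integral_0: "kernel_integral 0 a b c d e = qbeta a b c d e"
  unfolding kernel_integral_def qbeta_def qdiff_kernel_0 qbeta_weight_def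
  by (simp add: mult_ac)

text \<open>
Iterating the shift \<open>a \<mapsto> aq\<close> turns the linear factors into infinite products and sends \<open>a\<close> to 0, where the
integral is continuous. By the symmetry of the integral in \<open>a, b, e\<close>, the same step removes each of the
three parameters.
\<close>

lemma qbeta_eliminate_parameter:
  assumes nz: "c \<noteq> 0" "d \<noteq> 0" "qpoch_inf (b * c) q \<noteq> 0" "qpoch_inf (e * c) q \<noteq> 0"
      "qpoch_inf (b * d) q \<noteq> 0" "qpoch_inf (e * d) q \<noteq> 0"
    and ac: "qpoch_inf (a * c) q \<noteq> 0" "qpoch_inf (a * d) q \<noteq> 0"
  shows "qpoch_inf (a * c) q * qpoch_inf (a * d) q * qbeta a b c d e
       = qpoch_inf (a * b * c * d) q * qpoch_inf (a * c * d * e) q * qbeta 0 b c d e"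
proof (rule LIMSEQ_unique)
  have "qpoch (a * c) q n * qpoch (a * d) q n * qbeta a b c d e
      = qpoch (a * b * c * d) q n * qpoch (a * c * d * e) q n * qbeta (a * q ^ n) b c d e" for n
  proof (induction n)
    case (Suc n)
    have "qpoch_inf (a * q ^ n * c) q \<noteq> 0" "qpoch_inf (a * q ^ n * d) q \<noteq> 0"
      using ac[THEN qpoch_inf_shift_nonzero, of n] by (simp_all add: mult_ac)
    with nz have "(1 - a * q ^ n * c) * (1 - a * q ^ n * d) * qbeta (a * q ^ n) b c d e
      = (1 - a * q ^ n * b * c * d) * (1 - a * q ^ n * c * d * e) * qbeta (a * q ^ n * q) b c d e"
      by (intro qbeta_shift)
    note step = this
    have "qpoch (a * c) q (Suc n) * qpoch (a * d) q (Suc n) * qbeta a b c d e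
        = (1 - a * q ^ n * c) * (1 - a * q ^ n * d) * (qpoch (a * c) q n * qpoch (a * d) q n * qbeta a b c d e)"
      by (simp add: qpoch_Suc mult_ac)
    also have "\<dots> = qpoch (a * b * c * d) q n * qpoch (a * c * d * e) q n
        * ((1 - a * q ^ n * c) * (1 - a * q ^ n * d) * qbeta (a * q ^ n) b c d e)"
      unfolding Suc by (simp only: mult_ac)
    also have "\<dots> = qpoch (a * b * c * d) q (Suc n) * qpoch (a * c * d * e) q (Suc n) * qbeta (a * q ^ Suc n) b c d e"
      unfolding step by (simp add: qpoch_Suc mult_ac)
    finally show ?case .
  qed simp
  note iter = this
  show "(\<lambda>n. qpoch (a * c) q n * qpoch (a * d) q n * qbeta a b c d e)
      \<longlonglongrightarrow> qpoch_inf (a * c) q * qpoch_inf (a * d) q * qbeta a b c d e"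
    by (intro tendsto_intros qpoch_inf_LIMSEQ norm_q)
  have "(\<lambda>n. qbeta (a * q ^ n) b c d e) \<longlonglongrightarrow> qbeta 0 b c d e"
    using isCont_tendsto_compose[OF isCont_kernel_integral[of 0 b c d e] tendsto_mult_power_q]
    by (simp add: kernel_integral_0)
  then show "(\<lambda>n. qpoch (a * c) q n * qpoch (a * d) q n * qbeta a b c d e)
      \<longlonglongrightarrow> qpoch_inf (a * b * c * d) q * qpoch_inf (a * c * d * e) q * qbeta 0 b c d e"
    unfolding iter by (intro tendsto_intros qpoch_inf_LIMSEQ norm_q)
qed

text \<open>
Since \<open>(t/y)\<^sub>\<infinity> = (1 - t/y) (qt/y)\<^sub>\<infinity>\<close>, the function \<open>-(1-q) y (t/y)\<^sub>\<infinity>\<close> is a q-antiderivative.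
\<close>

lemma jackson0_qpoch_inf:
  assumes "x \<noteq> 0" "y \<noteq> 0"
  shows "jackson0 q x (\<lambda>t. qpoch_inf (q * t / y) q) = (1 - q) * y * (1 - qpoch_inf (x / y) q)"
proof -
  have "jackson0 q x (\<lambda>t. qpoch_inf (q * t / y) q) = (1 - q) * (- y * qpoch_inf (x / y) q - (- y * 1))"
  proof (rule jackson0_telescope[OF assms(1)])
    show "(\<lambda>n. - y * qpoch_inf (x * q ^ n / y) q) \<longlonglongrightarrow> - y * 1"
      using tendsto_qpoch_inf_orbit_divide[of 1] by (intro tendsto_mult tendsto_const) simp
    show "x * q ^ n * qpoch_inf (q * (x * q ^ n) / y) q
        = - y * qpoch_inf (x * q ^ n / y) q - - y * qpoch_inf (x * q ^ Suc n / y) q" for n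
      using assms(2) qpoch_inf_step[of "x * q ^ n / y"] by (simp add: field_simps)
  qed
  then show ?thesis
    by (simp add: algebra_simps)
qed

text \<open>
For \<open>e = q/c\<close> the factor \<open>(qt/c)\<^sub>\<infinity>\<close> cancels and the integral is elementary. This needs
\<open>(qd/c)\<^sub>\<infinity> \<noteq> 0\<close>, which the assumption on the norms guarantees. The value is stated in a form
antisymmetric in \<open>c\<close> and \<open>d\<close>, so that the other case follows by exchanging the endpoints.
\<close>

lemma qbeta_000_symmetric:
  assumes nz: "c \<noteq> 0" "d \<noteq> 0" and le: "norm d \<le> norm c"
  shows "qbeta 0 0 c d 0 = (1 - q) * (d - c) * qpoch_inf q q * qpoch_inf (d * q / c) q * qpoch_inf (c * q / d) q"
proof -
  have "norm (q * d / c) < 1"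
  proof -
    have "norm (q * d / c) = norm q * (norm d / norm c)"
      by (simp add: norm_mult norm_divide)
    also have "\<dots> \<le> norm q * 1"
      using le nz by (intro mult_left_mono) (auto simp: divide_simps)
    finally show ?thesis
      using norm_q by simp
  qed
  then have ec: "qpoch_inf (q / c * d) q \<noteq> 0"
    using qpoch_inf_nonzero_small by simp
  have "qbeta 0 0 c d (q / c) = jackson q c d (\<lambda>t. qpoch_inf (q * t / d) q)"
  proof -
    have "qpoch_inf (q * (c * q ^ n) / c) q \<noteq> 0" for n
      using qpoch_inf_shift_nonzero[of q n] nz by simp
    moreover have "qpoch_inf (q * (d * q ^ n) / c) q \<noteq> 0" for n
      using qpoch_inf_shift_nonzero[OF ec, of n] by (simp add: mult_ac)
    ultimately show ?thesis
      unfolding qbeta_def jackson_def by (intro arg_cong2[where f = minus] jackson0_cong) (use nz in auto)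
  qed
  also have "\<dots> = (1 - q) * d * qpoch_inf (c / d) q"
    unfolding jackson_def jackson0_qpoch_inf[OF nz(1,2)] jackson0_qpoch_inf[OF nz(2,2)]
    using nz by (simp add: algebra_simps)
  also have "\<dots> = (1 - q) * (d - c) * qpoch_inf (c * q / d) q"
  proof -
    have "d * qpoch_inf (c / d) q = (d - c) * qpoch_inf (c * q / d) q"
      using nz qpoch_inf_step[of "c / d"] by (simp add: field_simps)
    then show ?thesis
      by (simp add: mult.assoc)
  qed
  finally have "qbeta 0 0 c d (q / c) = (1 - q) * (d - c) * qpoch_inf (c * q / d) q" .
  moreover have "qpoch_inf (q / c * c) q * qpoch_inf (q / c * d) q * qbeta (q / c) 0 c d 0 = qbeta 0 0 c d 0"
    using qbeta_eliminate_parameter[of c d 0 0 "q / c"] nz ec by simp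
  ultimately show ?thesis
    using nz by (simp add: qbeta_swap(2)[of "q / c"] mult_ac)
qed

lemma qbeta_000:
  assumes nz: "c \<noteq> 0" "d \<noteq> 0"
  shows "qbeta 0 0 c d 0 = (1 - q) * d * qpoch_inf q q * qpoch_inf (d * q / c) q * qpoch_inf (c / d) q"
proof -
  have "qbeta 0 0 c d 0 = (1 - q) * (d - c) * qpoch_inf q q * qpoch_inf (d * q / c) q * qpoch_inf (c * q / d) q"
  proof (cases "norm d \<le> norm c")
    case True
    then show ?thesis
      using nz by (intro qbeta_000_symmetric)
  next
    case False
    then have "qbeta 0 0 d c 0 = (1 - q) * (c - d) * qpoch_inf q q * qpoch_inf (c * q / d) q * qpoch_inf (d * q / c) q"
      using nz by (intro qbeta_000_symmetric) auto
    moreover have "qbeta 0 0 c d 0 = - qbeta 0 0 d c 0"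
      by (simp add: qbeta_def jackson_def mult_ac)
    ultimately show ?thesis
      by (simp add: algebra_simps)
  qed
  moreover have "d * qpoch_inf (c / d) q = (d - c) * qpoch_inf (c * q / d) q"
    using nz qpoch_inf_step[of "c / d"] by (simp add: field_simps)
  ultimately show ?thesis
    by (metis (no_types, lifting) mult.assoc mult.commute)
qed

lemma qbeta_eval:
  assumes nz: "c \<noteq> 0" "d \<noteq> 0" "qpoch_inf (b * c) q \<noteq> 0" "qpoch_inf (e * c) q \<noteq> 0"
      "qpoch_inf (b * d) q \<noteq> 0" "qpoch_inf (e * d) q \<noteq> 0"
      "qpoch_inf (a * c) q \<noteq> 0" "qpoch_inf (a * d) q \<noteq> 0"
  shows "qbeta a b c d e = (1 - q) * d
     * (qpoch_inf q q * qpoch_inf (d * q / c) q * qpoch_inf (c / d) q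
        * qpoch_inf (a * b * c * d) q * qpoch_inf (b * c * d * e) q * qpoch_inf (a * c * d * e) q)
     / (qpoch_inf (a * c) q * qpoch_inf (a * d) q * qpoch_inf (b * c) q * qpoch_inf (b * d) q
        * qpoch_inf (e * c) q * qpoch_inf (e * d) q)"
proof -
  have 1: "qpoch_inf (a * c) q * qpoch_inf (a * d) q * qbeta a b c d e
       = qpoch_inf (a * b * c * d) q * qpoch_inf (a * c * d * e) q * qbeta 0 b c d e"
    using nz by (intro qbeta_eliminate_parameter)
  have 2: "qpoch_inf (b * c) q * qpoch_inf (b * d) q * qbeta 0 b c d e
       = qpoch_inf (b * c * d * e) q * qbeta 0 0 c d e"
    using qbeta_eliminate_parameter[of c d 0 e b] nz by (simp add: qbeta_swap(1)[of b])
  have 3: "qpoch_inf (e * c) q * qpoch_inf (e * d) q * qbeta 0 0 c d e = qbeta 0 0 c d 0"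
    using qbeta_eliminate_parameter[of c d 0 0 e] nz by (simp add: qbeta_swap(2)[of e])
  have "qbeta a b c d e * (qpoch_inf (a * c) q * qpoch_inf (a * d) q * qpoch_inf (b * c) q * qpoch_inf (b * d) q
        * qpoch_inf (e * c) q * qpoch_inf (e * d) q)
      = (qpoch_inf (a * c) q * qpoch_inf (a * d) q * qbeta a b c d e)
        * (qpoch_inf (b * c) q * qpoch_inf (b * d) q) * (qpoch_inf (e * c) q * qpoch_inf (e * d) q)"
    by (simp only: mult_ac)
  also have "\<dots> = qpoch_inf (a * b * c * d) q * qpoch_inf (a * c * d * e) q
      * (qpoch_inf (b * c) q * qpoch_inf (b * d) q * qbeta 0 b c d e) * (qpoch_inf (e * c) q * qpoch_inf (e * d) q)"
    unfolding 1 by (simp only: mult_ac)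
  also have "\<dots> = qpoch_inf (a * b * c * d) q * qpoch_inf (a * c * d * e) q * qpoch_inf (b * c * d * e) q
      * (qpoch_inf (e * c) q * qpoch_inf (e * d) q * qbeta 0 0 c d e)"
    unfolding 2 by (simp only: mult_ac)
  also have "\<dots> = (1 - q) * d
     * (qpoch_inf q q * qpoch_inf (d * q / c) q * qpoch_inf (c / d) q
        * qpoch_inf (a * b * c * d) q * qpoch_inf (b * c * d * e) q * qpoch_inf (a * c * d * e) q)"
    unfolding 3 qbeta_000[OF nz(1,2)] by (simp only: mult_ac)
  finally show ?thesis
    using nz by (simp add: eq_divide_eq)
qed

section \<open>Integrating the q-derivatives of the integrand\<close>

lemma Bseq_qdiff_kernel:
  assumes "qpoch_inf (a * x) q \<noteq> 0"
  shows "Bseq (\<lambda>n. qdiff_kernel q k a (x * q ^ n) r (e * (x * q ^ n)))"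
proof -
  obtain M where "\<And>n. norm (qdiff_kernel q k a (x * q ^ n) r (e * (x * q ^ n)))
      \<le> M * (\<Sum>j\<le>k. norm r ^ j * norm x ^ (k - j))"
    using bounded_qdiff_kernel_orbit[OF assms] by metis
  then show ?thesis
    by (rule BseqI')
qed

lemma kernel_integral_step:
  assumes "qpoch_inf (a * c) q \<noteq> 0" "qpoch_inf (a * d) q \<noteq> 0"
  shows "kernel_integral k a b c d e - (1 - a * b * c * d) * kernel_integral k (a * q) b c d e
       = a * (1 - q ^ Suc k) * kernel_integral (Suc k) a b c d e"
proof -
  have half: "jackson0 q x (\<lambda>t. qbeta_weight b c d e t * qdiff_kernel q k a t (b * c * d) (e * t))
      - (1 - a * b * c * d) * jackson0 q x (\<lambda>t. qbeta_weight b c d e t * qdiff_kernel q k (a * q) t (b * c * d) (e * t))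
      = a * (1 - q ^ Suc k) * jackson0 q x (\<lambda>t. qbeta_weight b c d e t * qdiff_kernel q (Suc k) a t (b * c * d) (e * t))"
    if x: "qpoch_inf (a * x) q \<noteq> 0" for x
  proof -
    have Bseq_F: "Bseq (\<lambda>n. qbeta_weight b c d e (x * q ^ n) * qdiff_kernel q k a' (x * q ^ n) (b * c * d) (e * (x * q ^ n)))"
      if "qpoch_inf (a' * x) q \<noteq> 0" for k a'
      by (intro Bseq_mult Bseq_qbeta_weight Bseq_qdiff_kernel that)
    have xq: "qpoch_inf (a * q * x) q \<noteq> 0"
      using qpoch_inf_shift_nonzero[OF x, of 1] by (simp add: mult_ac)
    have "jackson0 q x (\<lambda>t. 1 * (qbeta_weight b c d e t * qdiff_kernel q k a t (b * c * d) (e * t))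
        + (- (1 - a * b * c * d)) * (qbeta_weight b c d e t * qdiff_kernel q k (a * q) t (b * c * d) (e * t)))
      = jackson0 q x (\<lambda>t. a * (1 - q ^ Suc k) * (qbeta_weight b c d e t * qdiff_kernel q (Suc k) a t (b * c * d) (e * t))
        + 0 * (qbeta_weight b c d e t * qdiff_kernel q (Suc k) a t (b * c * d) (e * t)))"
    proof (rule jackson0_cong)
      fix n
      define t where "t = x * q ^ n"
      have "1 * (qbeta_weight b c d e t * qdiff_kernel q k a t (b * c * d) (e * t))
        + (- (1 - a * b * c * d)) * (qbeta_weight b c d e t * qdiff_kernel q k (a * q) t (b * c * d) (e * t))
        = qbeta_weight b c d e t * (qdiff_kernel q k a t (b * c * d) (e * t)
            - (1 - a * (b * c * d)) * qdiff_kernel q k (a * q) t (b * c * d) (e * t))"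
        by (simp add: algebra_simps)
      also have "qdiff_kernel q k a t (b * c * d) (e * t) - (1 - a * (b * c * d)) * qdiff_kernel q k (a * q) t (b * c * d) (e * t)
        = a * (1 - q ^ Suc k) * qdiff_kernel q (Suc k) a t (b * c * d) (e * t)"
        unfolding t_def using x by (intro qdiff_kernel_step qpoch_inf_orbit_nonzero)
      finally have "1 * (qbeta_weight b c d e t * qdiff_kernel q k a t (b * c * d) (e * t))
        + (- (1 - a * b * c * d)) * (qbeta_weight b c d e t * qdiff_kernel q k (a * q) t (b * c * d) (e * t))
        = a * (1 - q ^ Suc k) * (qbeta_weight b c d e t * qdiff_kernel q (Suc k) a t (b * c * d) (e * t))
        + 0 * (qbeta_weight b c d e t * qdiff_kernel q (Suc k) a t (b * c * d) (e * t))"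
        by (simp only: mult_zero_left add_0_right mult_ac)
      then show "1 * (qbeta_weight b c d e (x * q ^ n) * qdiff_kernel q k a (x * q ^ n) (b * c * d) (e * (x * q ^ n)))
        + (- (1 - a * b * c * d)) * (qbeta_weight b c d e (x * q ^ n) * qdiff_kernel q k (a * q) (x * q ^ n) (b * c * d) (e * (x * q ^ n)))
        = a * (1 - q ^ Suc k) * (qbeta_weight b c d e (x * q ^ n) * qdiff_kernel q (Suc k) a (x * q ^ n) (b * c * d) (e * (x * q ^ n)))
        + 0 * (qbeta_weight b c d e (x * q ^ n) * qdiff_kernel q (Suc k) a (x * q ^ n) (b * c * d) (e * (x * q ^ n)))"
        unfolding t_def .
    qed
    then show ?thesis
      unfolding jackson0_linear[OF Bseq_F[OF x] Bseq_F[OF xq]]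
        jackson0_linear[OF Bseq_F[OF x] Bseq_F[OF x]]
      by (simp only: mult_1_left mult_minus_left mult_zero_left add_0_right add_uminus_conv_diff)
  qed
  have combine: "(D - C) - \<alpha> * (D' - C') = \<beta> * (D'' - C'')"
    if "D - \<alpha> * D' = \<beta> * D''" "C - \<alpha> * C' = \<beta> * C''" for \<alpha> \<beta> C C' C'' D D' D'' :: complex
    unfolding right_diff_distrib that[symmetric] by simp
  show ?thesis
    unfolding kernel_integral_def jackson_def
    by (rule combine) (rule half; rule assms)+
qed

text \<open>
Both sides satisfy the same q-difference equation, from which the value at index \<open>k + 1\<close> is obtained from
those at index \<open>k\<close> after division by \<open>a\<close>. The factor \<open>1 - abcd\<close> on the left becomes \<open>1 - ad\<close> on the right,
which is accounted for by the quotient \<open>(abcd)\<^sub>\<infinity> / (ad)\<^sub>\<infinity>\<close>. For \<open>a = 0\<close> both sides are continuous and agree on a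
punctured neighbourhood.
\<close>

lemma kernel_integral_eval:
  assumes nz: "c \<noteq> 0" "d \<noteq> 0" "qpoch_inf (b * c) q \<noteq> 0" "qpoch_inf (e * c) q \<noteq> 0"
      "qpoch_inf (b * d) q \<noteq> 0" "qpoch_inf (e * d) q \<noteq> 0"
      and a: "qpoch_inf (a * c) q \<noteq> 0" "qpoch_inf (a * d) q \<noteq> 0"
  shows "kernel_integral k a b c d e = (1 - q) * d
     * (qpoch_inf q q * qpoch_inf (d * q / c) q * qpoch_inf (c / d) q * qpoch_inf (b * c * d * e) q)
     / (qpoch_inf (b * c) q * qpoch_inf (b * d) q * qpoch_inf (e * c) q * qpoch_inf (e * d) q)
     * (qpoch_inf (a * b * c * d) q / qpoch_inf (a * d) q * qdiff_kernel q k a c d (c * e))"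
  using a
proof (induction k arbitrary: a)
  case 0
  then show ?case
    using nz by (simp add: kernel_integral_0 qbeta_eval qdiff_kernel_0 mult_ac)
next
  case (Suc k)
  define C where "C = (1 - q) * d
     * (qpoch_inf q q * qpoch_inf (d * q / c) q * qpoch_inf (c / d) q * qpoch_inf (b * c * d * e) q)
     / (qpoch_inf (b * c) q * qpoch_inf (b * d) q * qpoch_inf (e * c) q * qpoch_inf (e * d) q)"
  define R where "R k a = C * (qpoch_inf (a * b * c * d) q / qpoch_inf (a * d) q * qdiff_kernel q k a c d (c * e))" for k a
  have IH: "kernel_integral k a b c d e = R k a"
    if "qpoch_inf (a * c) q \<noteq> 0" "qpoch_inf (a * d) q \<noteq> 0" for a
    unfolding R_def C_def using that by (rule Suc.IH)
  have nonzero_case: "kernel_integral (Suc k) a b c d e = R (Suc k) a"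
    if a: "qpoch_inf (a * c) q \<noteq> 0" "qpoch_inf (a * d) q \<noteq> 0" "a \<noteq> 0" for a
  proof -
    have aq: "qpoch_inf (a * q * c) q \<noteq> 0" "qpoch_inf (a * q * d) q \<noteq> 0"
      using a(1,2)[THEN qpoch_inf_shift_nonzero, of 1] by (simp_all add: mult_ac)
    define N D where "N = qpoch_inf (a * q * b * c * d) q" and "D = qpoch_inf (a * q * d) q"
    have N: "qpoch_inf (a * b * c * d) q = (1 - a * b * c * d) * N"
      unfolding N_def by (subst qpoch_inf_step) (simp add: mult_ac)
    have D: "qpoch_inf (a * d) q = (1 - a * d) * D"
      unfolding D_def by (subst qpoch_inf_step) (simp add: mult_ac)
    have D_nz: "1 - a * d \<noteq> 0" "D \<noteq> 0"
      using a(2) unfolding D by auto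
    define G where "G = C * (1 - a * b * c * d) * N / ((1 - a * d) * D)"
    have R_Suc: "R k a = G * qdiff_kernel q k a c d (c * e)" "R (Suc k) a = G * qdiff_kernel q (Suc k) a c d (c * e)"
      unfolding R_def G_def N D by simp_all
    moreover have "(1 - a * b * c * d) * R k (a * q) = G * ((1 - a * d) * qdiff_kernel q k (a * q) c d (c * e))"
      unfolding R_def G_def N_def[symmetric] D_def[symmetric] using D_nz by simp
    moreover have "qdiff_kernel q k a c d (c * e) - (1 - a * d) * qdiff_kernel q k (a * q) c d (c * e)
        = a * (1 - q ^ Suc k) * qdiff_kernel q (Suc k) a c d (c * e)"
      by (rule qdiff_kernel_step[OF a(1)])
    ultimately have "R k a - (1 - a * b * c * d) * R k (a * q) = G * (a * (1 - q ^ Suc k) * qdiff_kernel q (Suc k) a c d (c * e))"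
      by (metis right_diff_distrib)
    also have "\<dots> = a * (1 - q ^ Suc k) * R (Suc k) a"
      unfolding R_Suc by (simp only: mult_ac)
    finally have "R k a - (1 - a * b * c * d) * R k (a * q) = a * (1 - q ^ Suc k) * R (Suc k) a" .
    moreover have "R k a - (1 - a * b * c * d) * R k (a * q) = a * (1 - q ^ Suc k) * kernel_integral (Suc k) a b c d e"
      using kernel_integral_step[OF a(1,2), of k b e] unfolding IH[OF a(1,2)] IH[OF aq] .
    ultimately show ?thesis
      using a(3) one_minus_q_power_nonzero[of k] by simp
  qed
  have "kernel_integral (Suc k) a b c d e = R (Suc k) a"
  proof (cases "a = 0")
    case True
    have nz_near: "eventually (\<lambda>b. qpoch_inf (b * y) q \<noteq> 0) (at 0)" for y
      by (rule tendsto_imp_eventually_ne[OF tendsto_qpoch_inf_0[OF tendsto_mult_left_zero[OF tendsto_ident_at]]]) simp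
    have "((\<lambda>a. kernel_integral (Suc k) a b c d e) \<longlongrightarrow> R (Suc k) 0) (at 0)"
    proof (rule Lim_transform_eventually)
      have one: "((\<lambda>a. qpoch_inf (a * y) q) \<longlongrightarrow> 1) (at 0)" for y
        by (intro tendsto_qpoch_inf_0 tendsto_mult_left_zero tendsto_ident_at)
      have "((\<lambda>a. R (Suc k) a) \<longlongrightarrow> C * (1 / 1 * qdiff_kernel q (Suc k) 0 c d (c * e))) (at 0)"
        unfolding R_def mult.assoc[of _ b c] mult.assoc[of _ "b * c" d]
        by (intro tendsto_mult tendsto_divide tendsto_const one tendsto_qdiff_kernel tendsto_ident_at) simp
      then show "((\<lambda>a. R (Suc k) a) \<longlongrightarrow> R (Suc k) 0) (at 0)"
        by (simp add: R_def)
      show "eventually (\<lambda>a. R (Suc k) a = kernel_integral (Suc k) a b c d e) (at 0)"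
        using nz_near[of c] nz_near[of d] eventually_neq_at_within[of 0]
        by eventually_elim (simp add: nonzero_case)
    qed
    moreover have "((\<lambda>a. kernel_integral (Suc k) a b c d e) \<longlongrightarrow> kernel_integral (Suc k) 0 b c d e) (at 0)"
      using isCont_kernel_integral[of "Suc k" b c d e] by (simp add: isCont_def)
    ultimately show ?thesis
      unfolding True by (metis LIM_unique)
  qed (use nonzero_case Suc.prems in blast)
  then show ?case
    by (simp add: R_def C_def)
qed

section \<open>Summing over the order of the q-derivative\<close>

text \<open>
Writing \<open>(f;q)\<^sub>k = (f;q)\<^sub>j (f q^j;q)\<^sub>m\<close> with \<open>k = j + m\<close>, the sum over \<open>m\<close> is the q-binomial series with value
\<open>(f g s q^j)\<^sub>\<infinity> / (gs)\<^sub>\<infinity>\<close>. Rewriting every \<open>(y q^j)\<^sub>\<infinity>\<close> as \<open>(y)\<^sub>\<infinity> / (y;q)\<^sub>j\<close> turns the sum over \<open>j\<close> into the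
3-phi-2 series.
\<close>

lemma qdiff_kernel_generating_function:
  assumes gs: "norm (g * s) < 1" and gr: "norm (g * r) < 1"
    and as: "qpoch_inf (a * s) q \<noteq> 0" and aru: "qpoch_inf (a * r * u) q \<noteq> 0" and fgs: "qpoch_inf (f * g * s) q \<noteq> 0"
  shows "(\<lambda>k. qpoch f q k * g ^ k * qdiff_kernel q k a s r u) sums
     (qpoch_inf (a * r * u) q * qpoch_inf (f * g * s) q / (qpoch_inf (a * s) q * qpoch_inf (g * s) q)
       * phi32 f (a * s) u (f * g * s) (a * r * u) q (g * r))"
proof -
  define A where "A j = qpoch f q j * qpoch u q j / qpoch q q j
      * (qpoch_inf (a * r * u * q ^ j) q / qpoch_inf (a * s * q ^ j) q) * (g * r) ^ j" for j
  define F where "F j m = A j * (qpoch (f * q ^ j) q m / qpoch q q m * (g * s) ^ m)" for j m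
  have rows: "(\<Sum>m. F j m) = qpoch_inf (a * r * u) q * qpoch_inf (f * g * s) q / (qpoch_inf (a * s) q * qpoch_inf (g * s) q)
       * (qpochs [f, a * s, u] q j / qpochs [q, f * g * s, a * r * u] q j * (g * r) ^ j)" for j
  proof -
    have "(\<lambda>m. F j m) sums (A j * (qpoch_inf (f * q ^ j * (g * s)) q / qpoch_inf (g * s) q))"
      unfolding F_def by (intro sums_mult q_binomial gs)
    then have "(\<Sum>m. F j m) = A j * (qpoch_inf (f * g * s * q ^ j) q / qpoch_inf (g * s) q)"
      by (simp add: sums_iff mult_ac)
    moreover have "qpoch_inf y q = qpoch y q j * qpoch_inf (y * q ^ j) q" for y
      by (rule qpoch_inf_split)
    note split = this[of "a * s"] this[of "f * g * s"] this[of "a * r * u"]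
    have "qpoch (a * s) q j \<noteq> 0" "qpoch (f * g * s) q j \<noteq> 0" "qpoch (a * r * u) q j \<noteq> 0"
      "qpoch_inf (a * s * q ^ j) q \<noteq> 0"
      using as aru fgs unfolding split by auto
    ultimately show ?thesis
      unfolding split A_def qpochs_def by (simp add: field_simps)
  qed
  have antidiagonal: "(\<Sum>j\<le>k. F j (k - j)) = qpoch f q k * g ^ k * qdiff_kernel q k a s r u" for k
    unfolding qdiff_kernel_def sum_distrib_left
  proof (intro sum.cong refl)
    fix j assume "j \<in> {..k}"
    then have "qpoch f q k = qpoch f q j * qpoch (f * q ^ j) q (k - j)" "g ^ k = g ^ j * g ^ (k - j)"
      using qpoch_add[of f q j "k - j"] by (simp_all flip: power_add)
    then show "F j (k - j) = qpoch f q k * g ^ k * (r ^ j * s ^ (k - j) * qpoch u q j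
      * (qpoch_inf (a * r * u * q ^ j) q / qpoch_inf (a * s * q ^ j) q) / (qpoch q q j * qpoch q q (k - j)))"
      unfolding F_def A_def by (simp add: power_mult_distrib mult_ac)
  qed
  have "(\<lambda>(j, m). F j m) summable_on (UNIV \<times> UNIV)"
  proof -
    define N1 N2 N3 where "N1 = exp (norm f / (1 - norm q))" and "N2 = exp (norm u / (1 - norm q))"
      and "N3 = exp (norm (a * r * u) / (1 - norm q))"
    obtain L where L: "L > 0" "\<And>n. norm (inverse (qpoch_inf (a * s * q ^ n) q)) \<le> L"
      using bounded_inverse_orbit[OF as] by metis
    obtain M where M: "M > 0" "\<And>n. norm (inverse (qpoch q q n)) \<le> M"
      using bounded_inverse_qpoch_q by metis
    have mono: "exp (norm (y * q ^ j) / (1 - norm q)) \<le> exp (norm y / (1 - norm q))" for y j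
      using norm_mult_power_q_le[of y j] norm_q by (simp add: divide_right_mono)
    have N: "norm (qpoch f q j) \<le> N1" "norm (qpoch (f * q ^ j) q m) \<le> N1" "norm (qpoch u q j) \<le> N2"
      "norm (qpoch_inf (a * r * u * q ^ j) q) \<le> N3" for j m
      unfolding N1_def N2_def N3_def
      using norm_qpoch_le norm_qpoch_inf_le mono order_trans by blast+
    have N_pos: "N1 > 0" "N2 > 0" "N3 > 0"
      by (simp_all add: N1_def N2_def N3_def)
    show ?thesis
    proof (rule summable_on_product_dominated)
      show "summable (\<lambda>j. N1 * N2 * M * (N3 * L) * norm (g * r) ^ j)" "summable (\<lambda>m. N1 * M * norm (g * s) ^ m)"
        using gs gr by (intro summable_mult summable_geometric; simp)+
      fix j m
      show "0 \<le> N1 * N2 * M * (N3 * L) * norm (g * r) ^ j" "0 \<le> N1 * M * norm (g * s) ^ m"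
        using N_pos L(1) M(1) by simp_all
      have "norm (A j) \<le> N1 * N2 * M * (N3 * L) * norm (g * r) ^ j"
        unfolding A_def norm_mult norm_power divide_inverse
        using N[of j] N_pos L(1) L(2)[of j] M(1) M(2)[of j]
        by (intro mult_mono mult_nonneg_nonneg) auto
      moreover have "norm (qpoch (f * q ^ j) q m / qpoch q q m * (g * s) ^ m) \<le> N1 * M * norm (g * s) ^ m"
        unfolding norm_mult norm_power divide_inverse
        using N(2)[of j m] N_pos M(1) M(2)[of m] by (intro mult_mono mult_nonneg_nonneg) auto
      ultimately show "norm (F j m) \<le> N1 * N2 * M * (N3 * L) * norm (g * r) ^ j * (N1 * M * norm (g * s) ^ m)"
        unfolding F_def norm_mult[of "A j"] using N_pos L(1) M(1)
        by (intro mult_mono) auto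
    qed
  qed
  note summable = this
  define C where "C = qpoch_inf (a * r * u) q * qpoch_inf (f * g * s) q / (qpoch_inf (a * s) q * qpoch_inf (g * s) q)"
  define T where "T j = qpochs [f, a * s, u] q j / qpochs [q, f * g * s, a * r * u] q j * (g * r) ^ j" for j
  have "C \<noteq> 0"
    using as aru fgs qpoch_inf_nonzero_small[OF gs] by (simp add: C_def)
  have "summable (\<lambda>j. C * T j)"
    using sums_rows[OF summable] unfolding rows C_def T_def by (rule sums_summable)
  then have "summable T"
    using \<open>C \<noteq> 0\<close> by (simp add: summable_cmult_iff)
  then have "(\<Sum>j. C * T j) = C * phi32 f (a * s) u (f * g * s) (a * r * u) q (g * r)"
    unfolding phi32_def T_def by (rule suminf_mult)
  then show ?thesis
    using sums_antidiagonals[OF summable] unfolding antidiagonal rows C_def T_def by simp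
qed

lemma jackson0_suminf_kernel:
  assumes ax: "qpoch_inf (a * x) q \<noteq> 0" and gx: "norm (g * x) < 1" and gr: "norm (g * r) < 1"
    and W: "Bseq (\<lambda>n. W (x * q ^ n))"
  shows "(\<lambda>k. qpoch f q k * g ^ k * jackson0 q x (\<lambda>t. W t * qdiff_kernel q k a t r (e * t))) sums
     jackson0 q x (\<lambda>t. W t * (\<Sum>k. qpoch f q k * g ^ k * qdiff_kernel q k a t r (e * t)))"
proof -
  define G where "G n k = qpoch f q k * g ^ k * qdiff_kernel q k a (x * q ^ n) r (e * (x * q ^ n))" for n k
  define F where "F n k = W (x * q ^ n) * q ^ n * G n k" for n k
  obtain K where K: "K > 0" "\<And>n. norm (W (x * q ^ n)) \<le> K"
    using W unfolding Bseq_def by blast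
  obtain M where M: "M > 0"
    "\<And>k n. norm (qdiff_kernel q k a (x * q ^ n) r (e * (x * q ^ n))) \<le> M * (\<Sum>j\<le>k. norm r ^ j * norm x ^ (k - j))"
    using bounded_qdiff_kernel_orbit[OF ax] by metis
  define N where "N = exp (norm f / (1 - norm q))"
  have N: "N > 0" "\<And>n. norm (qpoch f q n) \<le> N"
    by (simp_all add: N_def norm_qpoch_le)
  define B where "B k = N * M * (\<Sum>j\<le>k. norm (g * r) ^ j * norm (g * x) ^ (k - j))" for k
  have B: "B k = N * norm g ^ k * (M * (\<Sum>j\<le>k. norm r ^ j * norm x ^ (k - j)))" for k
  proof -
    have "norm (g * r) ^ j * norm (g * x) ^ (k - j) = norm g ^ k * (norm r ^ j * norm x ^ (k - j))" if "j \<le> k" for j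
    proof -
      have "norm g ^ k = norm g ^ j * norm g ^ (k - j)"
        using that by (simp flip: power_add)
      then show ?thesis
        by (simp add: norm_mult power_mult_distrib)
    qed
    then have "(\<Sum>j\<le>k. norm (g * r) ^ j * norm (g * x) ^ (k - j)) = norm g ^ k * (\<Sum>j\<le>k. norm r ^ j * norm x ^ (k - j))"
      unfolding sum_distrib_left by (intro sum.cong) auto
    then show ?thesis
      by (simp add: B_def)
  qed
  have B_summable: "summable B"
    unfolding B_def using gx gr by (intro summable_mult summable_convolution_powers) auto
  have B_nonneg: "0 \<le> B k" for k
    unfolding B_def using N(1) M(1) by (auto intro!: mult_nonneg_nonneg sum_nonneg)
  have G_le: "norm (G n k) \<le> B k" for n k
    unfolding B G_def norm_mult norm_power using M N
    by (intro mult_mono mult_nonneg_nonneg) (auto intro: less_imp_le)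
  have summable: "(\<lambda>(n, k). F n k) summable_on (UNIV \<times> UNIV)"
  proof (rule summable_on_product_dominated)
    show "summable (\<lambda>n. K * norm q ^ n)"
      using norm_q by (simp add: summable_geometric)
    show "norm (F n k) \<le> K * norm q ^ n * B k" for n k
      unfolding F_def norm_mult norm_power using K G_le
      by (intro mult_mono mult_nonneg_nonneg) (auto intro: less_imp_le)
  qed (use K(1) B_summable B_nonneg in auto)
  have "summable (G n)" for n
    by (rule summable_comparison_test'[OF B_summable]) (rule G_le)
  then have rows: "(\<Sum>k. F n k) = W (x * q ^ n) * (\<Sum>k. G n k) * q ^ n" for n
    unfolding F_def by (subst suminf_mult) (simp_all add: mult_ac)
  have columns: "x * (1 - q) * (\<Sum>n. F n k)
      = qpoch f q k * g ^ k * jackson0 q x (\<lambda>t. W t * qdiff_kernel q k a t r (e * t))" for k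
  proof -
    have "summable (\<lambda>n. W (x * q ^ n) * qdiff_kernel q k a (x * q ^ n) r (e * (x * q ^ n)) * q ^ n)"
      by (rule summable_norm_cancel, rule summable_jackson[of "\<lambda>t. W t * qdiff_kernel q k a t r (e * t)"])
         (intro Bseq_mult W Bseq_qdiff_kernel ax)
    then have "(\<Sum>n. qpoch f q k * g ^ k * (W (x * q ^ n) * qdiff_kernel q k a (x * q ^ n) r (e * (x * q ^ n)) * q ^ n))
      = qpoch f q k * g ^ k * (\<Sum>n. W (x * q ^ n) * qdiff_kernel q k a (x * q ^ n) r (e * (x * q ^ n)) * q ^ n)"
      by (rule suminf_mult)
    moreover have "F n k = qpoch f q k * g ^ k * (W (x * q ^ n) * qdiff_kernel q k a (x * q ^ n) r (e * (x * q ^ n)) * q ^ n)" for n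
      by (simp add: F_def G_def)
    ultimately show ?thesis
      by (simp add: jackson0_def)
  qed
  have "(\<lambda>k. x * (1 - q) * (\<Sum>n. F n k)) sums (x * (1 - q) * (\<Sum>n. \<Sum>k. F n k))"
    by (intro sums_mult sums_columns summable)
  then show ?thesis
    unfolding columns rows by (simp add: jackson0_def G_def[abs_def])
qed

end

section \<open>The q-integral of the weighted basic hypergeometric series\<close>

theorem theorem6p1:
  fixes a b c d e f g q :: complex
  assumes "norm q < 1"
    and "Max {norm (b * c * d * g), norm (c * e), norm (c * g), norm (d * e), norm (d * g)} < 1"
    and "c \<noteq> 0" and "d \<noteq> 0"
    and "\<forall>n. \<forall>t\<in>{c, d}. a * t * q ^ n \<noteq> 1 \<and> b * t * q ^ n \<noteq> 1"
    and "\<forall>n. \<forall>t\<in>{c, d}. f * g * t * q ^ n \<noteq> 1 \<and> a * b * c * d * e * t * q ^ n \<noteq> 1"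
    and "\<forall>n. a * c * d * e * q ^ n \<noteq> 1"
  shows
    "jackson q c d (\<lambda>t.
        qpochs_inf [q * t / c, q * t / d, a * b * c * d * e * t, f * g * t] q
          / qpochs_inf [a * t, b * t, e * t, g * t] q
        * phi32 f (a * t) (e * t) (f * g * t) (a * b * c * d * e * t) q (b * c * d * g))
     = d * (1 - q)
        * qpochs_inf [q, d * q / c, c / d, a * b * c * d, b * c * d * e, a * c * d * e, c * f * g] q
        / qpochs_inf [a * c, a * d, b * c, b * d, c * e, c * g, d * e] q
        * phi32 f (a * c) (c * e) (c * f * g) (a * c * d * e) q (d * g)"
proof -
  note norm_q = assms(1)
  have small: "norm (b * c * d * g) < 1" "norm (c * e) < 1" "norm (c * g) < 1" "norm (d * e) < 1" "norm (d * g) < 1"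
    using assms(2) by simp_all
  have nz: "qpoch_inf (a * t) q \<noteq> 0" "qpoch_inf (b * t) q \<noteq> 0" "qpoch_inf (f * g * t) q \<noteq> 0"
    "qpoch_inf (a * b * c * d * e * t) q \<noteq> 0" "norm (e * t) < 1" "norm (g * t) < 1" if "t \<in> {c, d}" for t
    using that assms(5,6) small by (auto intro!: qpoch_inf_nonzero[OF norm_q] simp: mult.commute)
  have nz_acde: "qpoch_inf (a * c * d * e) q \<noteq> 0"
    using assms(7) by (intro qpoch_inf_nonzero[OF norm_q]) simp
  define I where "I = (\<lambda>t. qpochs_inf [q * t / c, q * t / d, a * b * c * d * e * t, f * g * t] q
          / qpochs_inf [a * t, b * t, e * t, g * t] q
        * phi32 f (a * t) (e * t) (f * g * t) (a * b * c * d * e * t) q (b * c * d * g))"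
  define S where "S = (\<lambda>t. \<Sum>k. qpoch f q k * g ^ k * qdiff_kernel q k a t (b * c * d) (e * t))"
  have integrand: "I (x * q ^ n) = qbeta_weight q b c d e (x * q ^ n) * S (x * q ^ n)" if x: "x \<in> {c, d}" for x n
  proof -
    define t where "t = x * q ^ n"
    have shift: "qpoch_inf (y * t) q \<noteq> 0" if "qpoch_inf (y * x) q \<noteq> 0" for y
      unfolding t_def using that by (rule qpoch_inf_orbit_nonzero[OF norm_q])
    have gt: "norm (g * t) < 1"
      using nz(6)[OF x] norm_mult_power_q_le[OF norm_q, of "g * x" n] by (simp add: t_def mult.assoc)
    have "(\<lambda>k. qpoch f q k * g ^ k * qdiff_kernel q k a t (b * c * d) (e * t)) sums
     (qpoch_inf (a * (b * c * d) * (e * t)) q * qpoch_inf (f * g * t) q / (qpoch_inf (a * t) q * qpoch_inf (g * t) q)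
       * phi32 f (a * t) (e * t) (f * g * t) (a * (b * c * d) * (e * t)) q (g * (b * c * d)))"
      using shift[OF nz(1)[OF x]] shift[OF nz(3)[OF x]] shift[OF nz(4)[OF x]] gt small(1)
      by (intro qdiff_kernel_generating_function[OF norm_q]) (simp_all add: mult_ac)
    then have "S t = qpoch_inf (a * b * c * d * e * t) q * qpoch_inf (f * g * t) q / (qpoch_inf (a * t) q * qpoch_inf (g * t) q)
       * phi32 f (a * t) (e * t) (f * g * t) (a * b * c * d * e * t) q (b * c * d * g)"
      unfolding S_def by (simp add: sums_iff mult_ac)
    then show ?thesis
      unfolding I_def qbeta_weight_def[OF norm_q] t_def[symmetric] qpochs_inf_def by (simp add: mult_ac)
  qed
  have sums: "(\<lambda>k. qpoch f q k * g ^ k * jackson0 q x (\<lambda>t. qbeta_weight q b c d e t * qdiff_kernel q k a t (b * c * d) (e * t)))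
      sums jackson0 q x I" if x: "x \<in> {c, d}" for x
  proof -
    have "jackson0 q x I = jackson0 q x (\<lambda>t. qbeta_weight q b c d e t * S t)"
      using integrand[OF x] by (rule jackson0_cong)
    moreover have "norm (g * (b * c * d)) < 1"
      using small(1) by (simp add: mult_ac)
    ultimately show ?thesis
      using jackson0_suminf_kernel[OF norm_q nz(1)[OF x] nz(6)[OF x] _ Bseq_qbeta_weight[OF norm_q]]
      by (simp add: S_def)
  qed
  define C where "C = (1 - q) * d
     * (qpoch_inf q q * qpoch_inf (d * q / c) q * qpoch_inf (c / d) q * qpoch_inf (b * c * d * e) q)
     / (qpoch_inf (b * c) q * qpoch_inf (b * d) q * qpoch_inf (e * c) q * qpoch_inf (e * d) q)
     * (qpoch_inf (a * b * c * d) q / qpoch_inf (a * d) q)"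
  have eval: "kernel_integral q k a b c d e = C * qdiff_kernel q k a c d (c * e)" for k
    unfolding C_def using nz[of c] nz[of d] assms(3,4)
    by (subst kernel_integral_eval[OF norm_q]) (simp_all add: qpoch_inf_nonzero_small[OF norm_q])
  have "(\<lambda>k. qpoch f q k * g ^ k * kernel_integral q k a b c d e) sums jackson q c d I"
    using sums_diff[OF sums[of d] sums[of c]]
    by (simp add: kernel_integral_def[OF norm_q] jackson_def right_diff_distrib)
  then have "(\<lambda>k. C * (qpoch f q k * g ^ k * qdiff_kernel q k a c d (c * e))) sums jackson q c d I"
    by (simp add: eval mult_ac)
  moreover have "(\<lambda>k. C * (qpoch f q k * g ^ k * qdiff_kernel q k a c d (c * e))) sums
     (C * (qpoch_inf (a * d * (c * e)) q * qpoch_inf (f * g * c) q / (qpoch_inf (a * c) q * qpoch_inf (g * c) q)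
       * phi32 f (a * c) (c * e) (f * g * c) (a * d * (c * e)) q (g * d)))"
    using nz[of c] nz_acde small
    by (intro sums_mult qdiff_kernel_generating_function[OF norm_q]) (simp_all add: mult_ac)
  ultimately have "jackson q c d I = C * (qpoch_inf (a * c * d * e) q * qpoch_inf (c * f * g) q / (qpoch_inf (a * c) q * qpoch_inf (c * g) q)
       * phi32 f (a * c) (c * e) (c * f * g) (a * c * d * e) q (d * g))"
    by (simp add: sums_iff mult_ac)
  then have "jackson q c d I = d * (1 - q)
      * qpochs_inf [q, d * q / c, c / d, a * b * c * d, b * c * d * e, a * c * d * e, c * f * g] q
      / qpochs_inf [a * c, a * d, b * c, b * d, c * e, c * g, d * e] q
      * phi32 f (a * c) (c * e) (c * f * g) (a * c * d * e) q (d * g)"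
    unfolding C_def qpochs_inf_def by (simp add: mult_ac)
  then show ?thesis
    unfolding I_def .
qed

end
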